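(* Let $d = 1$ and let $n > 1$ be an odd integer. Then the majority rule model $(\eta_t)_{t \geq 0}$ on $\mathbb{Z}$ with hyperedges of size $n$ clusters; that is, starting from any initial configuration $\eta_0 \subset \mathbb{Z}$, $$P(\eta_t(x) \neq \eta_t(y)) \to 0 \quad \text{as } t \to \infty, \quad \text{for all } x, y \in \mathbb{Z}.$$
   Context: The majority rule model on $\mathbb{Z}$ with parameter $n > 1$ is the continuous-time Markov process whose state at time $t$ is a configuration $\eta_t$, viewed either as a function $\mathbb{Z} \to \{0,1\}$ (where $\eta_t(x)$ is the opinion/type/state of vertex $x$) or as the subset of vertices with opinion 1. The hyperedges are the sets $h_x = \{x, x+1, \ldots, x+n-1\}$, $x \in \mathbb{Z}$. The process is constructed from independent rate one Poisson processes, one attached to each hyperedge: at each arrival time $t$ of the Poisson process attached to $h_x$, all vertices of $h_x$ become of type 0 if $\operatorname{card}(\eta_{t-} \cap h_x) < n/2$, and all vertices of $h_x$ become of type 1 if $\operatorname{card}(\eta_{t-} \cap h_x) \geq n/2$. Equivalently, its generator is $$Lf(\eta) = \sum_{x} \mathbf{1}\{\operatorname{card}(\eta \cap h_x) < n/2\}\,[f(\eta \setminus h_x) - f(\eta)] + \sum_{x} \mathbf{1}\{\operatorname{card}(\eta \cap h_x) \geq n/2\}\,[f(\eta \cup h_x) - f(\eta)].$$ *)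

theory Defs
  imports "HOL-Probability.Probability"
begin

section \<open>Poisson processes\<close>

text \<open>A Poisson process is represented by the random, locally finite set \<open>S \<omega>\<close> of its arrival
  times. In \<open>independent_increments\<close>, the sequence \<open>t\<close> may have repetitions, so it covers all
  finite partitions \<open>t 0 \<le> \<dots> \<le> t k\<close>.\<close>

definition arrivals :: "('w \<Rightarrow> real set) \<Rightarrow> real \<Rightarrow> real \<Rightarrow> 'w \<Rightarrow> nat" where
  "arrivals S s t \<omega> = card (S \<omega> \<inter> {s<..t})"

locale poisson_process = prob_space M for M :: "'w measure" +
  fixes rate :: real and S :: "'w \<Rightarrow> real set"
  assumes arrival_times_pos: "\<And>\<omega>. \<omega> \<in> space M \<Longrightarrow> S \<omega> \<subseteq> {0<..}"
    and locally_finite: "\<And>\<omega> t. \<omega> \<in> space M \<Longrightarrow> finite (S \<omega> \<inter> {0<..t})"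
    and measurable_arrivals:
      "\<And>s t. 0 \<le> s \<Longrightarrow> s \<le> t \<Longrightarrow> arrivals S s t \<in> measurable M (count_space UNIV)"
    and independent_increments:
      "\<And>t :: nat \<Rightarrow> real. 0 \<le> t 0 \<Longrightarrow> incseq t \<Longrightarrow>
         indep_vars (\<lambda>_. count_space UNIV) (\<lambda>i. arrivals S (t i) (t (Suc i))) UNIV"
    and poisson_increments:
      "\<And>s t. 0 \<le> s \<Longrightarrow> s < t \<Longrightarrow>
         distr M (count_space UNIV) (arrivals S s t) = measure_pmf (poisson_pmf (rate * (t - s)))"

text \<open>Mutual independence of a family of Poisson processes is mutual independence of the
  counting paths \<open>t \<mapsto> N\<^sub>t\<close>, \<open>t \<ge> 0\<close>, as random elements of the product space.\<close>

locale independent_poisson_processes = prob_space M for M :: "'w measure" +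
  fixes rate :: real and T :: "'i \<Rightarrow> 'w \<Rightarrow> real set"
  assumes poisson: "\<And>i. poisson_process M rate (T i)"
    and independent:
      "indep_vars (\<lambda>_. PiM {0..} (\<lambda>_. count_space UNIV))
         (\<lambda>i \<omega>. \<lambda>t\<in>{0..}. arrivals (T i) 0 t \<omega>) UNIV"


section \<open>The majority rule model on the integers\<close>

text \<open>A configuration is identified with the set of vertices of opinion 1.\<close>

type_synonym config = "int set"

definition hyperedge :: "nat \<Rightarrow> int \<Rightarrow> int set" where
  "hyperedge n x = {x..<x + int n}"

text \<open>The pointwise left limit \<open>\<eta>\<^bsub>t-\<^esub>\<close>; the trajectories below are piecewise constant at each
  vertex.\<close>

definition left_limit :: "(real \<Rightarrow> config) \<Rightarrow> real \<Rightarrow> config" where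
  "left_limit \<eta> t = {v. eventually (\<lambda>s. v \<in> \<eta> s) (at_left t)}"

definition majority_rule_trajectory ::
  "nat \<Rightarrow> (int \<Rightarrow> real set) \<Rightarrow> config \<Rightarrow> (real \<Rightarrow> config) \<Rightarrow> bool" where
  "majority_rule_trajectory n T \<eta>\<^sub>0 \<eta> \<longleftrightarrow>
     \<eta> 0 = \<eta>\<^sub>0 \<and>
     (\<forall>x. \<forall>t\<in>T x.
        (real (card (left_limit \<eta> t \<inter> hyperedge n x)) < real n / 2 \<longrightarrow>
           (\<forall>v\<in>hyperedge n x. v \<notin> \<eta> t)) \<and>
        (real (card (left_limit \<eta> t \<inter> hyperedge n x)) \<ge> real n / 2 \<longrightarrow>
           (\<forall>v\<in>hyperedge n x. v \<in> \<eta> t))) \<and>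
     (\<forall>v s t. 0 \<le> s \<and> s \<le> t \<and> (\<forall>x. v \<in> hyperedge n x \<longrightarrow> T x \<inter> {s<..t} = {}) \<longrightarrow>
        (v \<in> \<eta> t \<longleftrightarrow> v \<in> \<eta> s))"

text \<open>The update rule is imposed almost surely only: it is contradictory on the null event that
  two overlapping hyperedges have a common arrival time. For almost every realization of the
  clocks, every bounded time interval admits vertices arbitrarily far to the left and to the
  right across which no hyperedge rings, so that the trajectory is determined by the clocks and
  the initial configuration.\<close>

locale majority_rule_model = independent_poisson_processes M 1 T
  for M :: "'w measure" and T :: "int \<Rightarrow> 'w \<Rightarrow> real set" +
  fixes n :: nat and \<eta>\<^sub>0 :: config and \<eta> :: "real \<Rightarrow> 'w \<Rightarrow> config"
  assumes measurable_state: "\<And>t v. 0 \<le> t \<Longrightarrow> Measurable.pred M (\<lambda>\<omega>. v \<in> \<eta> t \<omega>)"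
    and trajectory:
      "AE \<omega> in M. majority_rule_trajectory n (\<lambda>x. T x \<omega>) \<eta>\<^sub>0 (\<lambda>t. \<eta> t \<omega>)"

definition clusters :: "'w measure \<Rightarrow> (real \<Rightarrow> 'w \<Rightarrow> config) \<Rightarrow> bool" where
  "clusters M \<eta> \<longleftrightarrow>
     (\<forall>x y. ((\<lambda>t. measure M {\<omega> \<in> space M. (x \<in> \<eta> t \<omega>) \<noteq> (y \<in> \<eta> t \<omega>)}) \<longlongrightarrow> 0) at_top)"

end

theory Submission
  imports Defs
begin

text \<open>Why the model clusters. Write \<open>n = 2 * r + 1\<close> and follow the probability \<open>p\<^sub>t(V)\<close> that both
  opinions are present on an interval \<open>V\<close> of vertices with \<open>L\<close> edges. Consider the ring of a
  hyperedge \<open>h\<close>.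

  \<^item> If \<open>h\<close> contains \<open>V\<close>, then \<open>V\<close> becomes unanimous; if \<open>h\<close> is contained in \<open>V\<close> or disjoint from it,
    then \<open>V\<close> can be mixed afterwards only if it was mixed before.
  \<^item> If \<open>h\<close> covers exactly the first \<open>i\<close> vertices of \<open>V\<close>, let \<open>W\<close> consist of the rest of \<open>V\<close> and the last
    \<open>r + 1\<close> vertices of \<open>h\<close>. These \<open>r + 1\<close> vertices are a majority of \<open>h\<close>, so if \<open>W\<close> is unanimous
    before the ring, then \<open>V\<close> is unanimous after it. Here \<open>W\<close> is an interval with \<open>L + r + 1 - i\<close>
    edges. The right end of \<open>V\<close> is symmetric.

  Summing over the hyperedges, the rates at which \<open>p\<^sub>t(V)\<close> is replaced by the probability for a longer
  or for a shorter interval balance: with \<open>m\<^sub>t(L)\<close> the supremum of \<open>p\<^sub>t(V)\<close> over all \<open>V\<close> with \<open>L\<close>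
  edges, \<open>L \<mapsto> m\<^sub>t(L)\<close> is driven by a walk on the lengths with mean-zero jumps, absorbed at \<open>0\<close>. In the
  limit \<open>t \<rightarrow> \<infinity>\<close>, the upper limits \<open>m(L)\<close> satisfy the inequality of a subharmonic function of that walk
  (\<open>limit_peak_subharmonic\<close>). Linear functions are harmonic, \<open>m\<close> is bounded by \<open>1\<close> and \<open>m(0) = 0\<close>;
  comparing \<open>m\<close> with lines of small slope gives \<open>m = 0\<close>
  (\<open>bounded_subharmonic_eq_0\<close>). Oddness of \<open>n\<close> removes the drift of the walk. Since the
  suprema run over all translates of \<open>V\<close>, the initial configuration may be arbitrary.

  The probabilistic content is the inequality \<open>mix_prob_one_step\<close> for \<open>p\<^bsub>t + h\<^esub>(V)\<close> with an error of
  order \<open>h\<^sup>2\<close>. It needs that the state at time \<open>t\<close> is independent of the rings after \<open>t\<close>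
  (\<open>state_indep_future_ring\<close>). This is not an assumption of the model: a trajectory is only known to
  obey the update rule. Outside an event of small probability, there are untouched vertices to the left
  and to the right, which screen off the rest of the line, and a fine time grid separates the finitely
  many rings between them. The state is then computed from finitely many increments of the clocks
  before \<open>t\<close>.\<close>

section \<open>Majority updates and unanimous intervals\<close>

definition majority_update :: "nat \<Rightarrow> int \<Rightarrow> config \<Rightarrow> config" where
  "majority_update n y \<zeta> =
     (if real (card (\<zeta> \<inter> hyperedge n y)) \<ge> real n / 2 then \<zeta> \<union> hyperedge n y
      else \<zeta> - hyperedge n y)"

definition mixed :: "int set \<Rightarrow> config \<Rightarrow> bool" where
  "mixed V \<zeta> \<longleftrightarrow> V \<inter> \<zeta> \<noteq> {} \<and> V - \<zeta> \<noteq> {}"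

definition window :: "int \<Rightarrow> nat \<Rightarrow> int set" where
  "window x L = {x..x + int L}"

lemma finite_hyperedge [simp]: "finite (hyperedge n y)"
  and card_hyperedge [simp]: "card (hyperedge n y) = n"
  by (simp_all add: hyperedge_def)

lemma mixed_window_0: "\<not> mixed (window x 0) \<zeta>"
  by (auto simp: mixed_def window_def)

lemma mixed_cong: "(\<And>v. v \<in> V \<Longrightarrow> v \<in> \<zeta> \<longleftrightarrow> v \<in> \<zeta>') \<Longrightarrow> mixed V \<zeta> \<longleftrightarrow> mixed V \<zeta>'"
  by (auto simp: mixed_def)

lemma majority_update_outside: "v \<notin> hyperedge n y \<Longrightarrow> v \<in> majority_update n y \<zeta> \<longleftrightarrow> v \<in> \<zeta>"
  by (auto simp: majority_update_def)

text \<open>A hyperedge inside \<open>V\<close> decides by the opinions inside \<open>V\<close> only. This locality lets two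
  configurations be compared on a screened interval.\<close>

lemma majority_update_cong:
  assumes "hyperedge n y \<subseteq> V" "\<And>v. v \<in> V \<Longrightarrow> v \<in> \<zeta> \<longleftrightarrow> v \<in> \<zeta>'" "v \<in> V"
  shows "v \<in> majority_update n y \<zeta> \<longleftrightarrow> v \<in> majority_update n y \<zeta>'"
proof -
  have "\<zeta> \<inter> hyperedge n y = \<zeta>' \<inter> hyperedge n y"
    using assms(1,2) by auto
  then show ?thesis
    using assms(2)[OF assms(3)] by (auto simp: majority_update_def)
qed

lemma not_mixed_update_covered:
  "V \<subseteq> hyperedge n y \<Longrightarrow> \<not> mixed V (majority_update n y \<zeta>)"
  by (auto simp: mixed_def majority_update_def)

text \<open>More than half of the vertices of the hyperedge decide the vote. If \<open>C\<close> is such a set, a common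
  opinion on \<open>C\<close> and on the part of \<open>V\<close> outside the hyperedge spreads to all of \<open>V\<close>.\<close>

lemma mixed_update_precursor:
  assumes C: "C \<subseteq> hyperedge n y" "n < 2 * card C"
    and W: "C \<subseteq> W" "V - hyperedge n y \<subseteq> W"
    and m: "mixed V (majority_update n y \<zeta>)"
  shows "mixed W \<zeta>"
proof (rule ccontr)
  assume "\<not> mixed W \<zeta>"
  then consider "W \<subseteq> \<zeta>" | "W \<inter> \<zeta> = {}"
    by (auto simp: mixed_def)
  then show False
  proof cases
    case 1
    have "card C \<le> card (\<zeta> \<inter> hyperedge n y)"
      using 1 C(1) W(1) by (intro card_mono) auto
    then have "majority_update n y \<zeta> = \<zeta> \<union> hyperedge n y"
      using C(2) by (auto simp: majority_update_def)
    then show False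
      using m 1 W(2) by (auto simp: mixed_def)
  next
    case 2
    have "card (\<zeta> \<inter> hyperedge n y) \<le> card (hyperedge n y - C)"
      using 2 W(1) by (intro card_mono) auto
    also have "\<dots> = n - card C"
      using C(1) by (simp add: card_Diff_subset finite_subset)
    finally have "2 * card (\<zeta> \<inter> hyperedge n y) < n"
      using C card_mono[OF finite_hyperedge C(1)] by simp
    then have "majority_update n y \<zeta> = \<zeta> - hyperedge n y"
      by (simp add: majority_update_def)
    then show False
      using m 2 W(2) by (auto simp: mixed_def)
  qed
qed

lemma mixed_update_inner_or_disjoint:
  assumes "hyperedge n y \<subseteq> V \<or> hyperedge n y \<inter> V = {}" "0 < n"
    and m: "mixed V (majority_update n y \<zeta>)"
  shows "mixed V \<zeta>"
  using assms(1)
proof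
  assume "hyperedge n y \<subseteq> V"
  then show ?thesis
    using mixed_update_precursor[of "hyperedge n y" n y V V \<zeta>] m \<open>0 < n\<close> by auto
next
  assume "hyperedge n y \<inter> V = {}"
  then show ?thesis
    using m mixed_cong[of V "majority_update n y \<zeta>" \<zeta>] majority_update_outside by blast
qed

text \<open>The last \<open>r + 1\<close> vertices of a hyperedge are a majority of it. When it covers the first \<open>i\<close> vertices of
  the window, they form an interval together with the rest of the window. This interval is longer than the
  window for \<open>i < r + 1\<close> and shorter for \<open>i > r + 1\<close>; when all \<open>i\<close> up to \<open>2 * r + 1\<close> occur, the two effects
  balance.\<close>

lemma mixed_update_left:
  assumes "mixed (window x L) (majority_update (2 * r + 1) (x - int (2 * r + 1) + int i) \<zeta>)"
    and "1 \<le> i" "i \<le> L" "i \<le> 2 * r + 1"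
  shows "mixed (window (x + int i - 1 - int r) (L + r + 1 - i)) \<zeta>"
  using assms
  by (intro mixed_update_precursor[OF _ _ _ _ assms(1),
        where C = "{x + int i - 1 - int r..x + int i - 1}"])
     (auto simp: hyperedge_def window_def)

lemma mixed_update_right:
  assumes "mixed (window x L) (majority_update (2 * r + 1) (x + int L + 1 - int i) \<zeta>)"
    and "1 \<le> i" "i \<le> L" "i \<le> 2 * r + 1"
  shows "mixed (window x (L + r + 1 - i)) \<zeta>"
  using assms
  by (intro mixed_update_precursor[OF _ _ _ _ assms(1),
        where C = "{x + int L + 1 - int i..x + int L + 1 - int i + int r}"])
     (auto simp: hyperedge_def window_def)

section \<open>Trajectories between and at isolated rings\<close>

lemma two_le_sum_cases:
  fixes f :: "'a \<Rightarrow> nat"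
  assumes "finite Y" "2 \<le> (\<Sum>y\<in>Y. f y)"
  obtains y where "y \<in> Y" "2 \<le> f y"
    | y z where "y \<in> Y" "z \<in> Y" "y \<noteq> z" "f y \<noteq> 0" "f z \<noteq> 0"
proof -
  obtain y where y: "y \<in> Y" "f y \<noteq> 0"
    using assms by (metis not_numeral_le_zero sum.neutral)
  have *: "(\<Sum>y\<in>Y. f y) = f y + (\<Sum>y\<in>Y - {y}. f y)"
    using assms(1) y(1) by (rule sum.remove)
  show thesis
  proof (cases "2 \<le> f y")
    case False
    then have "(\<Sum>y\<in>Y - {y}. f y) \<noteq> 0"
      using assms(2) * by simp
    then obtain z where "z \<in> Y - {y}" "f z \<noteq> 0"
      by (metis sum.neutral)
    then show thesis using y that(2) by auto
  qed (use y that in blast)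
qed

lemma sum_less_two_cases:
  fixes f :: "'a \<Rightarrow> nat"
  assumes "finite Y" "\<not> 2 \<le> (\<Sum>y\<in>Y. f y)"
  obtains "\<And>y. y \<in> Y \<Longrightarrow> f y = 0"
    | y where "y \<in> Y" "f y = 1" "\<And>z. z \<in> Y \<Longrightarrow> z \<noteq> y \<Longrightarrow> f z = 0"
proof (cases "\<exists>y\<in>Y. f y \<noteq> 0")
  case True
  then obtain y where y: "y \<in> Y" "f y \<noteq> 0" by auto
  have *: "(\<Sum>y\<in>Y. f y) = f y + (\<Sum>y\<in>Y - {y}. f y)"
    using assms(1) y(1) by (rule sum.remove)
  then have "(\<Sum>y\<in>Y - {y}. f y) = 0" "f y = 1"
    using assms(2) y(2) by auto
  then show thesis
    using assms(1) y(1) that(2)[of y] by auto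
qed (use that in blast)

lemma trajectory_constant:
  assumes "majority_rule_trajectory n T \<eta>\<^sub>0 \<eta>" "0 \<le> s" "s \<le> u"
    and "\<And>y. v \<in> hyperedge n y \<Longrightarrow> T y \<inter> {s<..u} = {}"
  shows "v \<in> \<eta> u \<longleftrightarrow> v \<in> \<eta> s"
  using assms unfolding majority_rule_trajectory_def by blast

lemma trajectory_at_ring:
  assumes "majority_rule_trajectory n T \<eta>\<^sub>0 \<eta>" "t \<in> T y" "v \<in> hyperedge n y"
  shows "v \<in> \<eta> t \<longleftrightarrow> real (card (left_limit \<eta> t \<inter> hyperedge n y)) \<ge> real n / 2"
  using assms unfolding majority_rule_trajectory_def by (meson not_le)

text \<open>The left limit in the update rule can be replaced by the state at time \<open>s\<close>, because no vertex of
  \<open>V\<close> is touched between \<open>s\<close> and the ring.\<close>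

lemma trajectory_single_ring:
  assumes traj: "majority_rule_trajectory n T \<eta>\<^sub>0 \<eta>" and "0 \<le> s"
    and one: "card (T y \<inter> {s<..u}) = 1"
    and V: "hyperedge n y \<subseteq> V"
    and other: "\<And>z. z \<noteq> y \<Longrightarrow> hyperedge n z \<inter> V \<noteq> {} \<Longrightarrow> T z \<inter> {s<..u} = {}"
    and "v \<in> V"
  shows "v \<in> \<eta> u \<longleftrightarrow> v \<in> majority_update n y (\<eta> s)"
proof -
  obtain \<tau> where \<tau>: "T y \<inter> {s<..u} = {\<tau>}"
    using one by (auto simp: card_1_singleton_iff)
  then have "\<tau> \<in> T y" "s < \<tau>" "\<tau> \<le> u" by auto
  have quiet: "T z \<inter> {s<..u} \<subseteq> {\<tau>}" if "w \<in> V" "w \<in> hyperedge n z" for w z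
    using other[of z] \<tau> that by (cases "z = y") auto
  show ?thesis
  proof (cases "v \<in> hyperedge n y")
    case False
    have "v \<in> \<eta> u \<longleftrightarrow> v \<in> \<eta> s"
    proof (rule trajectory_constant[OF traj \<open>0 \<le> s\<close>])
      show "s \<le> u"
        using \<open>s < \<tau>\<close> \<open>\<tau> \<le> u\<close> by simp
      fix z assume "v \<in> hyperedge n z"
      then show "T z \<inter> {s<..u} = {}"
        using False \<open>v \<in> V\<close> by (intro other) auto
    qed
    then show ?thesis
      using False by (simp add: majority_update_outside)
  next
    case True
    have before: "w \<in> \<eta> s' \<longleftrightarrow> w \<in> \<eta> s" if "w \<in> V" "s \<le> s'" "s' < \<tau>" for w s'
    proof (rule trajectory_constant[OF traj \<open>0 \<le> s\<close> \<open>s \<le> s'\<close>])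
      fix z assume "w \<in> hyperedge n z"
      then have "T z \<inter> {s<..u} \<subseteq> {\<tau>}"
        by (rule quiet[OF \<open>w \<in> V\<close>])
      moreover have "{s<..s'} \<subseteq> {s<..u} - {\<tau>}"
        using \<open>s' < \<tau>\<close> \<open>\<tau> \<le> u\<close> by auto
      ultimately show "T z \<inter> {s<..s'} = {}" by blast
    qed
    have "w \<in> left_limit \<eta> \<tau> \<longleftrightarrow> w \<in> \<eta> s" if "w \<in> V" for w
    proof -
      have "eventually (\<lambda>s'. (w \<in> \<eta> s') = (w \<in> \<eta> s)) (at_left \<tau>)"
        using eventually_at_left_real[OF \<open>s < \<tau>\<close>]
        by eventually_elim (rule before[OF that], auto)
      then have "eventually (\<lambda>s'. w \<in> \<eta> s') (at_left \<tau>) \<longleftrightarrow>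
          eventually (\<lambda>s'. w \<in> \<eta> s) (at_left \<tau>)"
        by (rule eventually_cong) simp
      then show ?thesis
        by (simp add: left_limit_def)
    qed
    then have "left_limit \<eta> \<tau> \<inter> hyperedge n y = \<eta> s \<inter> hyperedge n y"
      using V by auto
    then have "v \<in> \<eta> \<tau> \<longleftrightarrow> v \<in> majority_update n y (\<eta> s)"
      using trajectory_at_ring[OF traj \<open>\<tau> \<in> T y\<close> True] True
      by (simp add: majority_update_def)
    moreover have "v \<in> \<eta> u \<longleftrightarrow> v \<in> \<eta> \<tau>"
    proof (rule trajectory_constant[OF traj _ \<open>\<tau> \<le> u\<close>])
      show "0 \<le> \<tau>"
        using \<open>0 \<le> s\<close> \<open>s < \<tau>\<close> by simp
      fix z assume "v \<in> hyperedge n z"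
      then have "T z \<inter> {s<..u} \<subseteq> {\<tau>}"
        by (rule quiet[OF \<open>v \<in> V\<close>])
      moreover have "{\<tau><..u} \<subseteq> {s<..u} - {\<tau>}"
        using \<open>s < \<tau>\<close> by auto
      ultimately show "T z \<inter> {\<tau><..u} = {}" by blast
    qed
    ultimately show ?thesis by simp
  qed
qed

section \<open>Counts of independent Poisson processes\<close>

context poisson_process
begin

lemma finite_arrivals: "\<omega> \<in> space M \<Longrightarrow> 0 \<le> s \<Longrightarrow> finite (S \<omega> \<inter> {s<..t})"
  by (rule finite_subset[OF _ locally_finite[of \<omega> t]]) auto

lemma arrivals_eq_0_iff:
  "\<omega> \<in> space M \<Longrightarrow> 0 \<le> s \<Longrightarrow> arrivals S s t \<omega> = 0 \<longleftrightarrow> S \<omega> \<inter> {s<..t} = {}"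
  using finite_arrivals[of \<omega> s t] by (simp add: arrivals_def)

lemma arrivals_diff:
  assumes "\<omega> \<in> space M" "0 \<le> s" "s \<le> t"
  shows "arrivals S s t \<omega> = arrivals S 0 t \<omega> - arrivals S 0 s \<omega>"
proof -
  have "S \<omega> \<inter> {0<..t} = (S \<omega> \<inter> {0<..s}) \<union> (S \<omega> \<inter> {s<..t})"
    using assms by auto
  moreover have "card \<dots> = card (S \<omega> \<inter> {0<..s}) + card (S \<omega> \<inter> {s<..t})"
    using assms finite_arrivals by (intro card_Un_disjoint) auto
  ultimately show ?thesis by (simp add: arrivals_def)
qed

lemma prob_arrivals:
  assumes "0 \<le> s" "s < t"
  shows "prob {\<omega> \<in> space M. arrivals S s t \<omega> \<in> B} =
    measure_pmf.prob (poisson_pmf (rate * (t - s))) B"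
proof -
  have "measure (distr M (count_space UNIV) (arrivals S s t)) B =
      prob (arrivals S s t -` B \<inter> space M)"
    using assms by (intro measure_distr measurable_arrivals) auto
  also have "arrivals S s t -` B \<inter> space M = {\<omega> \<in> space M. arrivals S s t \<omega> \<in> B}"
    by auto
  finally show ?thesis
    using poisson_increments[OF assms] by simp
qed

lemma prob_no_arrival:
  assumes "0 < rate" "0 \<le> s" "s < t"
  shows "prob {\<omega> \<in> space M. arrivals S s t \<omega> = 0} = exp (- (rate * (t - s)))"
  using prob_arrivals[OF assms(2,3), of "{0}"] assms(1,3)
  by (simp add: measure_pmf_single)

lemma prob_some_arrival:
  assumes "0 < rate" "0 \<le> s" "s < t"
  shows "prob {\<omega> \<in> space M. arrivals S s t \<omega> \<noteq> 0} = 1 - exp (- (rate * (t - s)))"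
proof -
  have "{\<omega> \<in> space M. arrivals S s t \<omega> = 0} \<in> events"
    using measurable_sets[OF measurable_arrivals[OF assms(2) less_imp_le[OF assms(3)]], of "{0}"]
    by (simp add: vimage_def Int_def conj_commute)
  then have "prob (space M - {\<omega> \<in> space M. arrivals S s t \<omega> = 0}) = 1 - exp (- (rate * (t - s)))"
    using prob_no_arrival[OF assms] by (simp add: prob_compl)
  moreover have "space M - {\<omega> \<in> space M. arrivals S s t \<omega> = 0} =
      {\<omega> \<in> space M. arrivals S s t \<omega> \<noteq> 0}"
    by auto
  ultimately show ?thesis by simp
qed

text \<open>The bound is of second order in the length of the interval, which makes such events negligible
  on a fine time grid.\<close>

lemma prob_two_arrivals:
  assumes "0 < rate" "0 \<le> s" "s < t"
  shows "prob {\<omega> \<in> space M. 2 \<le> arrivals S s t \<omega>} \<le> (rate * (t - s))\<^sup>2"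
proof -
  define \<mu> where "\<mu> = rate * (t - s)"
  have "0 < \<mu>" using assms by (simp add: \<mu>_def)
  have "{2..} = - {0, 1 :: nat}" by auto
  then have "measure_pmf.prob (poisson_pmf \<mu>) {2..} =
      1 - measure_pmf.prob (poisson_pmf \<mu>) {0, 1}"
    using measure_pmf.prob_compl[of "{0, 1}" "poisson_pmf \<mu>"] by (simp add: Compl_eq_Diff_UNIV)
  also have "\<dots> = 1 - (1 + \<mu>) * exp (- \<mu>)"
    using \<open>0 < \<mu>\<close> by (simp add: measure_measure_pmf_finite algebra_simps)
  also have "\<dots> \<le> 1 - (1 + \<mu>) * (1 - \<mu>)"
    using \<open>0 < \<mu>\<close> exp_ge_add_one_self[of "- \<mu>"] by (intro diff_left_mono mult_left_mono) auto
  also have "\<dots> = \<mu>\<^sup>2" by (simp add: power2_eq_square algebra_simps)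
  finally show ?thesis
    using prob_arrivals[OF assms(2,3), of "{2..}"] by (simp add: \<mu>_def)
qed

end

lemma (in prob_space) prob_diff_le_exceptional:
  assumes "A \<in> events" "E \<in> events" "B \<in> events"
    and "AE \<omega> in M. \<omega> \<notin> B \<longrightarrow> (\<omega> \<in> A \<longleftrightarrow> \<omega> \<in> E)"
  shows "\<bar>prob A - prob E\<bar> \<le> prob B"
proof -
  have "prob A \<le> prob (E \<union> B)"
    using assms by (intro finite_measure_mono_AE) auto
  also have "\<dots> \<le> prob E + prob B"
    using assms by (intro measure_Un_le)
  finally have 1: "prob A \<le> prob E + prob B" .
  have "prob E \<le> prob (A \<union> B)"
    using assms by (intro finite_measure_mono_AE) auto
  also have "\<dots> \<le> prob A + prob B"
    using assms by (intro measure_Un_le)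
  finally show ?thesis using 1 by linarith
qed

context independent_poisson_processes
begin

abbreviation count :: "real \<Rightarrow> real \<Rightarrow> 'i \<Rightarrow> 'w \<Rightarrow> nat" where
  "count s t x \<equiv> arrivals (T x) s t"

lemma measurable_count [measurable]:
  "0 \<le> s \<Longrightarrow> s \<le> t \<Longrightarrow> count s t x \<in> measurable M (count_space UNIV)"
  by (rule poisson_process.measurable_arrivals[OF poisson])

lemma events_count [measurable, simp]:
  "0 \<le> s \<Longrightarrow> s \<le> t \<Longrightarrow> {\<omega> \<in> space M. Q (count s t x \<omega>)} \<in> events"
  using measurable_sets[OF measurable_count, of s t "{k. Q k}" x]
  by (simp add: vimage_def Int_def conj_commute)

text \<open>The clocks are independent as random paths and each clock has independent increments. Together
  this makes the whole array of increments independent: the probability of a finite intersection factorizes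
  first over the clocks and then over the time steps.\<close>

lemma indep_counts:
  fixes t :: "nat \<Rightarrow> real"
  assumes t: "0 \<le> t 0" "incseq t"
  shows "indep_vars (\<lambda>_. count_space UNIV)
    (\<lambda>p. count (t (snd p)) (t (Suc (snd p))) (fst p)) UNIV"
    (is "indep_vars _ ?X UNIV")
proof -
  have t0: "0 \<le> t i" and ts: "t i \<le> t (Suc i)" for i
    using t incseqD[OF t(2), of 0 i] by (auto simp: incseq_Suc_iff)
  let ?P = "PiM UNIV (\<lambda>_::nat. count_space (UNIV :: nat set))"
  let ?D = "\<lambda>f i. f (t (Suc i)) - f (t i) :: nat"
  have D: "?D \<in> measurable (PiM {0..} (\<lambda>_. count_space UNIV)) ?P"
  proof (rule measurable_PiM_single')
    fix i
    have "(\<lambda>f. f (t j)) \<in> measurable (PiM {0..} (\<lambda>_. count_space (UNIV :: nat set)))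
        (count_space UNIV)" for j
      using t0 by (intro measurable_component_singleton) auto
    note component = this
    have "(\<lambda>f. f (t (Suc i)) - c) \<in> measurable (PiM {0..} (\<lambda>_. count_space UNIV))
        (count_space UNIV)" for c :: nat
      by (rule measurable_compose[OF component]) simp
    from measurable_compose_countable[OF this component]
    show "(\<lambda>f. ?D f i) \<in> measurable (PiM {0..} (\<lambda>_. count_space UNIV)) (count_space UNIV)" .
  qed auto
  have Z: "indep_vars (\<lambda>_. ?P) (\<lambda>x \<omega>. ?D (\<lambda>u\<in>{0..}. count 0 u x \<omega>)) UNIV"
    by (rule indep_vars_compose2[OF independent D])
  have ZX: "?D (\<lambda>u\<in>{0..}. count 0 u x \<omega>) i = ?X (x, i) \<omega>" if "\<omega> \<in> space M" for x i \<omega>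
    using t0 ts poisson_process.arrivals_diff[OF poisson that t0 ts] by simp
  have rv: "random_variable (count_space UNIV) (?X p)" for p
    using t0 ts by simp
  have "indep_sets (\<lambda>p. {?X p -` A \<inter> space M |A. A \<in> sets (count_space UNIV)}) UNIV"
    unfolding indep_sets_def
  proof (intro conjI ballI allI impI)
    show "{?X p -` A \<inter> space M |A. A \<in> sets (count_space UNIV)} \<subseteq> events" for p
      using measurable_sets[OF rv] by auto
  next
    fix J A assume J: "J \<noteq> {}" "finite J"
      and "A \<in> (\<Pi> p\<in>J. {?X p -` A \<inter> space M |A. A \<in> sets (count_space UNIV)})"
    then have "\<forall>p\<in>J. \<exists>B. A p = ?X p -` B \<inter> space M" by auto
    then obtain B where B: "\<And>p. p \<in> J \<Longrightarrow> A p = ?X p -` B p \<inter> space M" by metis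
    define B' where "B' p = (if p \<in> J then B p else UNIV)" for p
    \<comment> \<open>Enlarge the index set to a rectangle; the events added are certain.\<close>
    define I where "I = fst ` J"
    define K where "K = snd ` J"
    have fin: "finite I" "finite K" "I \<noteq> {}" "K \<noteq> {}"
      using J by (simp_all add: I_def K_def)
    have IK: "J \<subseteq> I \<times> K"
      by (simp only: I_def K_def subset_fst_snd)
    let ?C = "\<lambda>x. \<Inter>i\<in>K. (\<lambda>f. f i) -` B' (x, i) \<inter> space ?P"
    have C: "?C x \<in> sets ?P" for x
      using fin by (intro sets.finite_INT) (auto intro!: measurable_sets[OF measurable_component_singleton])
    have row: "(\<lambda>\<omega>. ?D (\<lambda>u\<in>{0..}. count 0 u x \<omega>)) -` ?C x \<inter> space M =
        (\<Inter>i\<in>K. ?X (x, i) -` B' (x, i) \<inter> space M)" for x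
      using ZX fin by (auto simp: space_PiM)
    have "(\<Inter>p\<in>J. A p) = (\<Inter>x\<in>I. \<Inter>i\<in>K. ?X (x, i) -` B' (x, i) \<inter> space M)"
    proof (intro equalityI subsetI)
      fix \<omega> assume \<omega>: "\<omega> \<in> (\<Inter>p\<in>J. A p)"
      then have "\<omega> \<in> space M"
        using B \<open>J \<noteq> {}\<close> by blast
      moreover have "?X p \<omega> \<in> B' p" for p
        using \<omega> B[of p] by (cases "p \<in> J") (auto simp: B'_def)
      ultimately show "\<omega> \<in> (\<Inter>x\<in>I. \<Inter>i\<in>K. ?X (x, i) -` B' (x, i) \<inter> space M)"
        by blast
    next
      fix \<omega> assume *: "\<omega> \<in> (\<Inter>x\<in>I. \<Inter>i\<in>K. ?X (x, i) -` B' (x, i) \<inter> space M)"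
      have "\<omega> \<in> ?X p -` B p \<inter> space M" if "p \<in> J" for p
      proof -
        have "fst p \<in> I" "snd p \<in> K"
          using that by (auto simp: I_def K_def)
        then have "\<omega> \<in> ?X (fst p, snd p) -` B' (fst p, snd p) \<inter> space M"
          using * by blast
        then show ?thesis
          using that by (simp add: B'_def)
      qed
      then show "\<omega> \<in> (\<Inter>p\<in>J. A p)" using B by blast
    qed
    also have "prob \<dots> = prob (\<Inter>x\<in>I. (\<lambda>\<omega>. ?D (\<lambda>u\<in>{0..}. count 0 u x \<omega>)) -` ?C x \<inter> space M)"
      by (simp only: row)
    also have "\<dots> = (\<Prod>x\<in>I. prob ((\<lambda>\<omega>. ?D (\<lambda>u\<in>{0..}. count 0 u x \<omega>)) -` ?C x \<inter> space M))"
      using fin C by (intro indep_varsD[OF Z]) auto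
    also have "\<dots> = (\<Prod>x\<in>I. prob (\<Inter>i\<in>K. ?X (x, i) -` B' (x, i) \<inter> space M))"
      by (simp only: row)
    also have "\<dots> = (\<Prod>x\<in>I. \<Prod>i\<in>K. prob (?X (x, i) -` B' (x, i) \<inter> space M))"
    proof (rule prod.cong[OF refl])
      fix x
      show "prob (\<Inter>i\<in>K. ?X (x, i) -` B' (x, i) \<inter> space M) =
          (\<Prod>i\<in>K. prob (?X (x, i) -` B' (x, i) \<inter> space M))"
        using fin
        by (simp only: fst_conv snd_conv,
            intro indep_varsD[OF poisson_process.independent_increments[OF poisson t]]) auto
    qed
    also have "\<dots> = (\<Prod>p\<in>I \<times> K. prob (?X p -` B' p \<inter> space M))"
      by (subst prod.cartesian_product) (simp add: case_prod_unfold)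
    also have "\<dots> = (\<Prod>p\<in>J. prob (?X p -` B' p \<inter> space M))"
      using IK fin by (intro prod.mono_neutral_right) (auto simp: B'_def prob_space)
    also have "\<dots> = (\<Prod>p\<in>J. prob (A p))"
      using B by (intro prod.cong) (auto simp: B'_def)
    finally show "prob (\<Inter>p\<in>J. A p) = (\<Prod>p\<in>J. prob (A p))" .
  qed
  then show ?thesis
    using rv by (simp add: indep_vars_def2)
qed

lemma prob_two_counts:
  assumes "0 \<le> s" "s \<le> u" "x \<noteq> y"
  shows "prob {\<omega> \<in> space M. Q (count s u x \<omega>) \<and> R (count s u y \<omega>)} =
    prob {\<omega> \<in> space M. Q (count s u x \<omega>)} * prob {\<omega> \<in> space M. R (count s u y \<omega>)}"
proof -
  define t where "t i = (if i = 0 then s else u)" for i :: nat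
  have t: "0 \<le> t 0" "incseq t"
    using assms by (auto simp: t_def incseq_Suc_iff)
  define B where "B p = (if p = (x, 0::nat) then {k. Q k} else {k. R k})" for p
  let ?E = "\<lambda>p. count (t (snd p)) (t (Suc (snd p))) (fst p) -` B p \<inter> space M"
  have "prob (\<Inter>p\<in>{(x, 0), (y, 0)}. ?E p) = (\<Prod>p\<in>{(x, 0), (y, 0)}. prob (?E p))"
    by (rule indep_varsD[OF indep_counts[OF t]]) auto
  also have "\<dots> = prob (?E (x, 0)) * prob (?E (y, 0))"
    using \<open>x \<noteq> y\<close> by simp
  also have "?E (x, 0) = {\<omega> \<in> space M. Q (count s u x \<omega>)}"
    by (auto simp: B_def t_def)
  also have "?E (y, 0) = {\<omega> \<in> space M. R (count s u y \<omega>)}"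
    using \<open>x \<noteq> y\<close> by (auto simp: B_def t_def)
  also have "(\<Inter>p\<in>{(x, 0), (y, 0)}. ?E p) =
      {\<omega> \<in> space M. Q (count s u x \<omega>) \<and> R (count s u y \<omega>)}"
    using \<open>x \<noteq> y\<close> by (auto simp: B_def t_def)
  finally show ?thesis .
qed

lemma events_crowded [measurable]:
  assumes "0 \<le> s" "s \<le> u"
  shows "{\<omega> \<in> space M. 2 \<le> (\<Sum>y\<in>Y. count s u y \<omega>)} \<in> events"
proof -
  have "(\<lambda>\<omega>. \<Sum>y\<in>Y. count s u y \<omega>) \<in> measurable M (count_space UNIV)"
    using assms by (intro measurable_sum_nat measurable_count)
  from measurable_sets[OF this, of "{2..}"] show ?thesis
    by (simp add: vimage_def Int_def conj_commute)
qed

text \<open>Either one clock rings twice or two distinct clocks ring; each case has probability at most the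
  square of the expected number of rings of one clock.\<close>

lemma prob_crowded_le:
  assumes "finite Y" "0 < rate" "0 \<le> s" "s < u"
  shows "prob {\<omega> \<in> space M. 2 \<le> (\<Sum>y\<in>Y. count s u y \<omega>)} \<le> (real (card Y) * (rate * (u - s)))\<^sup>2"
proof -
  define E where "E p = {\<omega> \<in> space M. if fst p = snd p then 2 \<le> count s u (fst p) \<omega>
    else count s u (fst p) \<omega> \<noteq> 0 \<and> count s u (snd p) \<omega> \<noteq> 0}" for p
  have su: "s \<le> u" using assms by simp
  have E: "E p \<in> events" for p
    using events_count[OF \<open>0 \<le> s\<close> su, of "\<lambda>k. 2 \<le> k" "fst p"]
      sets.Int[OF events_count[OF \<open>0 \<le> s\<close> su, of "\<lambda>k. k \<noteq> 0" "fst p"]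
        events_count[OF \<open>0 \<le> s\<close> su, of "\<lambda>k. k \<noteq> 0" "snd p"]]
    by (cases "fst p = snd p") (simp_all add: E_def Int_def conj_ac)
  have le: "prob (E p) \<le> (rate * (u - s))\<^sup>2" for p
  proof (cases "fst p = snd p")
    case True
    then show ?thesis
      using poisson_process.prob_two_arrivals[OF poisson assms(2-4), of "fst p"]
      by (simp add: E_def)
  next
    case False
    have some: "prob {\<omega> \<in> space M. count s u x \<omega> \<noteq> 0} \<le> rate * (u - s)" for x
      using poisson_process.prob_some_arrival[OF poisson assms(2-4), of x]
        exp_ge_add_one_self[of "- (rate * (u - s))"] by linarith
    have "prob (E p) = prob {\<omega> \<in> space M. count s u (fst p) \<omega> \<noteq> 0} *
        prob {\<omega> \<in> space M. count s u (snd p) \<omega> \<noteq> 0}"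
      using False prob_two_counts[OF \<open>0 \<le> s\<close> su False, of "\<lambda>k. k \<noteq> 0" "\<lambda>k. k \<noteq> 0"]
      by (simp add: E_def)
    also have "\<dots> \<le> (rate * (u - s)) * (rate * (u - s))"
      using some assms by (intro mult_mono) auto
    finally show ?thesis by (simp add: power2_eq_square)
  qed
  have "prob {\<omega> \<in> space M. 2 \<le> (\<Sum>y\<in>Y. count s u y \<omega>)} \<le> prob (\<Union>p\<in>Y \<times> Y. E p)"
  proof (rule finite_measure_mono)
    show "{\<omega> \<in> space M. 2 \<le> (\<Sum>y\<in>Y. count s u y \<omega>)} \<subseteq> (\<Union>p\<in>Y \<times> Y. E p)"
    proof
      fix \<omega> assume "\<omega> \<in> {\<omega> \<in> space M. 2 \<le> (\<Sum>y\<in>Y. count s u y \<omega>)}"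
      then have \<omega>: "\<omega> \<in> space M" and "2 \<le> (\<Sum>y\<in>Y. count s u y \<omega>)" by auto
      from assms(1) this(2) show "\<omega> \<in> (\<Union>p\<in>Y \<times> Y. E p)"
      proof (cases rule: two_le_sum_cases)
        case (1 y)
        then show ?thesis using \<omega> by (intro UN_I[of "(y, y)"]) (auto simp: E_def)
      next
        case (2 y z)
        then show ?thesis using \<omega> by (intro UN_I[of "(y, z)"]) (auto simp: E_def)
      qed
    qed
  qed (use E assms in auto)
  also have "\<dots> \<le> (\<Sum>p\<in>Y \<times> Y. prob (E p))"
    using assms E by (intro measure_UNION_le) auto
  also have "\<dots> \<le> (\<Sum>p\<in>Y \<times> Y. (rate * (u - s))\<^sup>2)"
    by (intro sum_mono le)
  also have "\<dots> = (real (card Y) * (rate * (u - s)))\<^sup>2"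
    by (simp add: card_cartesian_product power2_eq_square)
  finally show ?thesis .
qed

text \<open>Disjoint blocks of clocks are independent, so it is unlikely that all of many blocks contain a
  ring. A block without a ring will be the set of hyperedges that contain one vertex.\<close>

lemma prob_all_blocks_hit:
  assumes "0 < rate" "0 < t" "0 < n"
    and K: "\<And>j. finite (K j)" "\<And>j. card (K j) = n" "disjoint_family K"
  shows "{\<omega> \<in> space M. \<forall>j<J. \<exists>y\<in>K j. count 0 t y \<omega> \<noteq> 0} \<in> events" (is "?A \<in> _")
    and "prob {\<omega> \<in> space M. \<forall>j<J. \<exists>y\<in>K j. count 0 t y \<omega> \<noteq> 0} =
      (1 - exp (- (rate * t)) ^ n) ^ J"
proof -
  define g where "g i = (if i = 0 then 0 else t)" for i :: nat
  have g: "0 \<le> g 0" "incseq g"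
    using assms by (auto simp: g_def incseq_Suc_iff)
  let ?X = "\<lambda>p. count (g (snd p)) (g (Suc (snd p))) (fst p)"
  let ?K = "\<lambda>j. K j \<times> {0::nat}"
  let ?C = "\<lambda>_. count_space (UNIV :: nat set)"
  have "indep_vars (\<lambda>j. PiM (?K j) ?C) (\<lambda>j \<omega>. \<lambda>p\<in>?K j. ?X p \<omega>) UNIV"
    using K(3) by (intro indep_vars_restrict[OF indep_counts[OF g]])
      (auto simp: disjoint_family_on_def)
  then have *: "indep_vars (\<lambda>_. count_space UNIV)
      (\<lambda>j \<omega>. \<exists>p\<in>?K j. (\<lambda>p\<in>?K j. ?X p \<omega>) p \<noteq> 0) UNIV"
  proof (rule indep_vars_compose2[where Y = "\<lambda>j f. \<exists>p\<in>?K j. f p \<noteq> 0"])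
    fix j
    have "PiM (?K j) ?C = count_space (PiE (?K j) (\<lambda>_. UNIV))"
      using K(1) by (intro count_space_PiM_finite) auto
    then show "(\<lambda>f. \<exists>p\<in>?K j. f p \<noteq> 0) \<in> measurable (PiM (?K j) ?C) (count_space UNIV)"
      by simp
  qed
  define H where "H j \<omega> \<longleftrightarrow> (\<exists>y\<in>K j. count 0 t y \<omega> \<noteq> 0)" for j \<omega>
  have "(\<lambda>j \<omega>. \<exists>p\<in>?K j. (\<lambda>p\<in>?K j. ?X p \<omega>) p \<noteq> 0) = H"
    by (intro ext) (simp add: H_def g_def)
  with * have indep: "indep_vars (\<lambda>_. count_space UNIV) H UNIV"
    by (simp only:)
  have rv: "random_variable (count_space UNIV) (H j)" for j
    using indep by (simp add: indep_vars_def2)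
  have ev: "H j -` B \<inter> space M \<in> events" for j B
    using measurable_sets[OF rv, of B] by simp
  have one: "prob (H j -` {True} \<inter> space M) = 1 - exp (- (rate * t)) ^ n" for j
  proof -
    have "K j \<noteq> {}"
      using K(2)[of j] \<open>0 < n\<close> by auto
    have "prob (\<Inter>p\<in>?K j. ?X p -` {0} \<inter> space M) = (\<Prod>p\<in>?K j. prob (?X p -` {0} \<inter> space M))"
    proof (rule indep_varsD[OF indep_counts[OF g], where A = "\<lambda>_. {0}"])
      show "?K j \<noteq> {}" "finite (?K j)" "?K j \<subseteq> UNIV"
        using \<open>K j \<noteq> {}\<close> K(1)[of j] by auto
    qed simp
    also have "\<dots> = (\<Prod>p\<in>?K j. exp (- (rate * t)))"
    proof (rule prod.cong[OF refl])
      fix p assume "p \<in> ?K j"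
      then have "snd p = 0" by auto
      then have "?X p -` {0} \<inter> space M = {\<omega> \<in> space M. count 0 t (fst p) \<omega> = 0}"
        by (auto simp: g_def)
      also have "prob \<dots> = exp (- (rate * (t - 0)))"
        by (rule poisson_process.prob_no_arrival[OF poisson \<open>0 < rate\<close> order_refl \<open>0 < t\<close>])
      finally show "prob (?X p -` {0} \<inter> space M) = exp (- (rate * t))"
        by (simp only: diff_zero)
    qed
    also have "\<dots> = exp (- (rate * t)) ^ n"
      by (simp only: prod_constant card_cartesian_product K(2)) simp
    also have "(\<Inter>p\<in>?K j. ?X p -` {0} \<inter> space M) = space M - (H j -` {True} \<inter> space M)"
    proof (intro equalityI subsetI)
      fix \<omega> assume \<omega>: "\<omega> \<in> (\<Inter>p\<in>?K j. ?X p -` {0} \<inter> space M)"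
      then have "\<omega> \<in> ?X (y, 0) -` {0} \<inter> space M" if "y \<in> K j" for y
        using that by blast
      then show "\<omega> \<in> space M - (H j -` {True} \<inter> space M)"
        using \<open>K j \<noteq> {}\<close> by (auto simp: H_def g_def)
    qed (auto simp: H_def g_def)
    finally show ?thesis
      using prob_compl[OF ev[of j "{True}"]] by simp
  qed
  have A: "{\<omega> \<in> space M. \<forall>j<J. H j \<omega>} =
      (if J = 0 then space M else \<Inter>j\<in>{..<J}. H j -` {True} \<inter> space M)"
    by auto
  have "(\<Inter>j\<in>{..<J}. H j -` {True} \<inter> space M) \<in> events" if "J \<noteq> 0"
    using that ev by (intro sets.finite_INT) auto
  then have "{\<omega> \<in> space M. \<forall>j<J. H j \<omega>} \<in> events"
    by (simp only: A sets.top split: if_split) blast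
  then show "?A \<in> events"
    by (simp only: H_def)
  have "prob {\<omega> \<in> space M. \<forall>j<J. H j \<omega>} = (1 - exp (- (rate * t)) ^ n) ^ J"
  proof (cases "J = 0")
    case False
    then have "prob {\<omega> \<in> space M. \<forall>j<J. H j \<omega>} = prob (\<Inter>j\<in>{..<J}. H j -` {True} \<inter> space M)"
      by (simp only: A if_False)
    also have "\<dots> = (\<Prod>j\<in>{..<J}. prob (H j -` {True} \<inter> space M))"
    proof (rule indep_varsD[OF indep, where A = "\<lambda>_. {True}"])
      show "{..<J} \<noteq> {}" using False by auto
    qed auto
    finally show ?thesis by (simp add: one)
  qed (simp add: prob_space)
  then show "prob ?A = (1 - exp (- (rate * t)) ^ n) ^ J"
    by (simp only: H_def)
qed

end

section \<open>The state depends on the past of the clocks\<close>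

text \<open>The state computed from the numbers \<open>c (y, i)\<close> of rings of \<open>y\<close> in the \<open>i\<close>-th time step, as if each
  step contained at most one ringing hyperedge of \<open>Y\<close>. Steps with several are skipped, an arbitrary choice
  that matters on an event of small probability only. Unlike a trajectory, this is a function of finitely
  many integers and hence measurable with respect to the counts.\<close>

fun discretized :: "nat \<Rightarrow> int set \<Rightarrow> (int \<times> nat \<Rightarrow> nat) \<Rightarrow> config \<Rightarrow> nat \<Rightarrow> config" where
  "discretized n Y c \<zeta> 0 = \<zeta>"
| "discretized n Y c \<zeta> (Suc i) =
     (if \<exists>!y. y \<in> Y \<and> c (y, i) \<noteq> 0
      then majority_update n (THE y. y \<in> Y \<and> c (y, i) \<noteq> 0) (discretized n Y c \<zeta> i)
      else discretized n Y c \<zeta> i)"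

lemma discretized_cong:
  "(\<And>y i. y \<in> Y \<Longrightarrow> i < k \<Longrightarrow> c (y, i) = c' (y, i)) \<Longrightarrow>
    discretized n Y c \<zeta> k = discretized n Y c' \<zeta> k"
proof (induction k)
  case (Suc k)
  have "(\<lambda>y. y \<in> Y \<and> c (y, k) \<noteq> 0) = (\<lambda>y. y \<in> Y \<and> c' (y, k) \<noteq> 0)"
    using Suc.prems by auto
  then show ?case
    using Suc by simp
qed simp

text \<open>A hyperedge that rings contains neither of the untouched vertices \<open>l\<close> and \<open>r\<close>, so it lies inside
  \<open>{l..r}\<close> or is disjoint from it. Hence the states on \<open>{l..r}\<close> evolve without information from outside.
  The positions of \<open>l\<close> and \<open>r\<close> depend on the realization, but \<open>discretized\<close> does not refer to them.\<close>

lemma discretized_agrees: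
  fixes g :: "nat \<Rightarrow> real"
  assumes traj: "majority_rule_trajectory n T \<eta>\<^sub>0 \<eta>"
    and g: "g 0 = 0" "incseq g"
    and fin: "\<And>y s. finite (T y \<inter> {0<..s})"
    and untouched: "\<And>y. l \<in> hyperedge n y \<or> r \<in> hyperedge n y \<Longrightarrow> T y \<inter> {0<..g k} = {}"
    and Y: "finite Y" "{l - int n..r} \<subseteq> Y"
    and c: "\<And>y i. c (y, i) = card (T y \<inter> {g i<..g (Suc i)})"
    and sparse: "\<And>i. i < k \<Longrightarrow> \<not> 2 \<le> (\<Sum>y\<in>Y. c (y, i))"
    and "i \<le> k" "v \<in> {l..r}"
  shows "v \<in> discretized n Y c \<eta>\<^sub>0 i \<longleftrightarrow> v \<in> \<eta> (g i)"
  using \<open>i \<le> k\<close> \<open>v \<in> {l..r}\<close>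
proof (induction i arbitrary: v)
  case 0
  then show ?case using traj g by (simp add: majority_rule_trajectory_def)
next
  case (Suc i)
  have gi: "0 \<le> g i" "g i \<le> g (Suc i)" "g (Suc i) \<le> g k"
    using g Suc.prems incseqD[OF g(2)] by (auto simp flip: g(1))
  have none: "T y \<inter> {g i<..g (Suc i)} = {}" if "c (y, i) = 0" for y
  proof -
    have "finite (T y \<inter> {g i<..g (Suc i)})"
      using gi by (intro finite_subset[OF _ fin[of y "g (Suc i)"]]) auto
    then show ?thesis using that c by simp
  qed
  have inY: "z \<in> Y" if "w \<in> hyperedge n z" "w \<in> {l..r}" for z w
    using that Y by (auto simp: hyperedge_def)
  have steady: "v \<in> \<eta> (g (Suc i)) \<longleftrightarrow> v \<in> \<eta> (g i)"
    if "\<And>z. z \<in> Y \<Longrightarrow> v \<in> hyperedge n z \<Longrightarrow> c (z, i) = 0"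
    using that none inY[OF _ Suc.prems(2)] by (intro trajectory_constant[OF traj gi(1,2)]) blast
  have "\<not> 2 \<le> (\<Sum>y\<in>Y. c (y, i))" using sparse Suc.prems by simp
  from Y(1) this show ?case
  proof (cases rule: sum_less_two_cases)
    case 1
    then have "discretized n Y c \<eta>\<^sub>0 (Suc i) = discretized n Y c \<eta>\<^sub>0 i" by auto
    then show ?thesis using steady 1 Suc by simp
  next
    case (2 y)
    have the: "(\<exists>!y. y \<in> Y \<and> c (y, i) \<noteq> 0) \<and> (THE y. y \<in> Y \<and> c (y, i) \<noteq> 0) = y"
      using 2 by (intro conjI the_equality ex1I[of _ y]) force+
    then have step: "discretized n Y c \<eta>\<^sub>0 (Suc i) = majority_update n y (discretized n Y c \<eta>\<^sub>0 i)"
      by simp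
    have IH: "w \<in> discretized n Y c \<eta>\<^sub>0 i \<longleftrightarrow> w \<in> \<eta> (g i)" if "w \<in> {l..r}" for w
      using Suc.IH Suc.prems(1) that by simp
    show ?thesis
    proof (cases "hyperedge n y \<inter> {l..r} = {}")
      case True
      then have "v \<notin> hyperedge n y" using Suc.prems(2) by auto
      then show ?thesis
        using step IH[OF Suc.prems(2)] steady 2(3) by (metis majority_update_outside)
    next
      case False
      have "T y \<inter> {g i<..g (Suc i)} \<noteq> {}"
        using c[of y i] 2(2) by auto
      then have "T y \<inter> {0<..g k} \<noteq> {}"
        using gi by fastforce
      then have "l \<notin> hyperedge n y" "r \<notin> hyperedge n y"
        using untouched by auto
      then have sub: "hyperedge n y \<subseteq> {l..r}"
        using False by (auto simp: hyperedge_def)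
      have "v \<in> \<eta> (g (Suc i)) \<longleftrightarrow> v \<in> majority_update n y (\<eta> (g i))"
      proof (rule trajectory_single_ring[OF traj gi(1) _ sub _ Suc.prems(2)])
        show "card (T y \<inter> {g i<..g (Suc i)}) = 1"
          using c[of y i] 2(2) by simp
        show "T z \<inter> {g i<..g (Suc i)} = {}" if "z \<noteq> y" "hyperedge n z \<inter> {l..r} \<noteq> {}" for z
          using that inY 2(3) by (intro none) blast
      qed
      also have "\<dots> \<longleftrightarrow> v \<in> majority_update n y (discretized n Y c \<eta>\<^sub>0 i)"
        using majority_update_cong[OF sub IH Suc.prems(2)] by simp
      finally show ?thesis using step by simp
    qed
  qed
qed

context majority_rule_model
begin

lemma events_mixed [measurable]:
  assumes "0 \<le> t" "finite V"
  shows "{\<omega> \<in> space M. mixed V (\<eta> t \<omega>)} \<in> events"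
proof -
  have "{\<omega> \<in> space M. mixed V (\<eta> t \<omega>)} =
      {\<omega> \<in> space M. (\<exists>v\<in>V. v \<in> \<eta> t \<omega>) \<and> (\<exists>v\<in>V. \<not> v \<in> \<eta> t \<omega>)}"
    by (auto simp: mixed_def)
  moreover note measurable_state[OF \<open>0 \<le> t\<close>, measurable]
  ultimately show ?thesis
    using \<open>finite V\<close> by simp
qed

lemma discretized_event_indep:
  fixes g :: "nat \<Rightarrow> real" and k :: nat and y :: int and Q :: "config \<Rightarrow> bool"
  assumes g: "0 \<le> g 0" "incseq g" and Y: "finite Y"
  defines "E \<equiv> {\<omega> \<in> space M. Q (discretized n Y
      (\<lambda>p. count (g (snd p)) (g (Suc (snd p))) (fst p) \<omega>) \<eta>\<^sub>0 k)}"
    and "D \<equiv> {\<omega> \<in> space M. count (g k) (g (Suc k)) y \<omega> \<noteq> 0}"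
  shows "E \<in> events" and "prob (E \<inter> D) = prob E * prob D"
proof -
  let ?X = "\<lambda>p. count (g (snd p)) (g (Suc (snd p))) (fst p)"
  let ?C = "\<lambda>_. count_space (UNIV :: nat set)"
  let ?I = "Y \<times> {..<k}"
  let ?J = "{(y, k)}"
  define ZI where "ZI = (\<lambda>\<omega>. \<lambda>p\<in>?I. ?X p \<omega>)"
  define ZJ where "ZJ = (\<lambda>\<omega>. \<lambda>p\<in>?J. ?X p \<omega>)"
  have ind: "indep_var (PiM ?I ?C) ZI (PiM ?J ?C) ZJ"
    unfolding ZI_def ZJ_def by (rule indep_var_restrict[OF indep_counts[OF g]]) auto
  have P: "PiM ?I ?C = count_space (PiE ?I (\<lambda>_. UNIV))" "PiM ?J ?C = count_space (PiE ?J (\<lambda>_. UNIV))"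
    by (rule count_space_PiM_finite; use Y in simp)+
  define A where "A = {f \<in> PiE ?I (\<lambda>_. UNIV). Q (discretized n Y f \<eta>\<^sub>0 k)}"
  define B where "B = {f \<in> PiE ?J (\<lambda>_. UNIV :: nat set). f (y, k) \<noteq> 0}"
  have AB: "A \<in> sets (PiM ?I ?C)" "B \<in> sets (PiM ?J ?C)"
    unfolding P A_def B_def sets_count_space by blast+
  have ZI: "ZI \<omega> \<in> A \<longleftrightarrow> Q (discretized n Y (\<lambda>p. ?X p \<omega>) \<eta>\<^sub>0 k)" for \<omega>
  proof -
    have "discretized n Y (ZI \<omega>) \<eta>\<^sub>0 k = discretized n Y (\<lambda>p. ?X p \<omega>) \<eta>\<^sub>0 k"
      by (rule discretized_cong) (simp add: ZI_def)
    moreover have "ZI \<omega> \<in> PiE ?I (\<lambda>_. UNIV)"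
      by (simp add: ZI_def)
    ultimately show ?thesis by (simp add: A_def)
  qed
  have ZJ: "ZJ \<omega> \<in> B \<longleftrightarrow> count (g k) (g (Suc k)) y \<omega> \<noteq> 0" for \<omega>
    by (simp add: ZJ_def B_def)
  have E: "ZI -` A \<inter> space M = E"
    by (simp only: E_def vimage_def ZI) blast
  have D: "ZJ -` B \<inter> space M = D"
    by (simp only: D_def vimage_def ZJ) blast
  from measurable_sets[OF indep_var_rv1[OF ind] AB(1)] show "E \<in> events"
    by (simp only: E)
  have "(\<lambda>\<omega>. (ZI \<omega>, ZJ \<omega>)) -` (A \<times> B) \<inter> space M = E \<inter> D"
    unfolding E[symmetric] D[symmetric] by blast
  with indep_varD[OF ind AB] show "prob (E \<inter> D) = prob E * prob D"
    by (simp only: E D)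
qed

text \<open>A vertex is contained in \<open>n\<close> hyperedges, and vertices at distance at least \<open>n\<close> share none.\<close>

lemma prob_all_touched:
  fixes f :: "nat \<Rightarrow> int" and J :: nat
  assumes "0 < t" "0 < n" and f: "\<And>i j. i < j \<Longrightarrow> int n \<le> \<bar>f i - f j\<bar>"
  defines "A \<equiv> {\<omega> \<in> space M. \<forall>j<J. \<exists>y. f j \<in> hyperedge n y \<and> count 0 t y \<omega> \<noteq> 0}"
  shows "A \<in> events" and "prob A = (1 - exp (- t) ^ n) ^ J"
proof -
  define K where "K j = {f j - int n<..f j}" for j
  have *: "f j \<in> hyperedge n y \<longleftrightarrow> y \<in> K j" for j y
    by (auto simp: hyperedge_def K_def)
  have A: "A = {\<omega> \<in> space M. \<forall>j<J. \<exists>y\<in>K j. count 0 t y \<omega> \<noteq> 0}"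
    unfolding A_def * Bex_def ..
  have K1: "finite (K j)" and K2: "card (K j) = n" for j
    by (simp_all add: K_def)
  have "K i \<inter> K j = {}" if "i < j" for i j
    using f[OF that] by (auto simp: K_def)
  then have disj: "disjoint_family K"
    unfolding disjoint_family_on_def by (metis Int_commute linorder_neqE_nat)
  note hit = prob_all_blocks_hit[where K = K and J = J and n = n and t = t,
      OF zero_less_one \<open>0 < t\<close> \<open>0 < n\<close> K1 K2 disj]
  show "A \<in> events"
    unfolding A by (rule hit(1))
  show "prob A = (1 - exp (- t) ^ n) ^ J"
    unfolding A using hit(2) by (simp only: mult_1)
qed

text \<open>The exceptional event is the union of three: none of \<open>J\<close> candidate vertices not left of any vertex of \<open>V\<close> is
  untouched during \<open>{0<..t}\<close>, the same on the other side, or one of the \<open>k\<close> steps of the time grid is crowded. First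
  \<open>J\<close> is chosen, which fixes the finite set \<open>Y\<close> of hyperedges between the candidates, and then \<open>k\<close>.\<close>

lemma state_approximation:
  assumes "0 < t" "0 < h" "0 < n" "finite V" "0 < \<epsilon>"
  shows "\<exists>E\<in>events. \<bar>prob ({\<omega> \<in> space M. mixed V (\<eta> t \<omega>)}) - prob E\<bar> \<le> \<epsilon> \<and>
     \<bar>prob ({\<omega> \<in> space M. mixed V (\<eta> t \<omega>)} \<inter> {\<omega> \<in> space M. count t (t + h) y \<omega> \<noteq> 0}) -
       prob (E \<inter> {\<omega> \<in> space M. count t (t + h) y \<omega> \<noteq> 0})\<bar> \<le> \<epsilon> \<and>
     prob (E \<inter> {\<omega> \<in> space M. count t (t + h) y \<omega> \<noteq> 0}) =
       prob E * prob {\<omega> \<in> space M. count t (t + h) y \<omega> \<noteq> 0}"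
proof -
  let ?A = "{\<omega> \<in> space M. mixed V (\<eta> t \<omega>)}"
  let ?D = "{\<omega> \<in> space M. count t (t + h) y \<omega> \<noteq> 0}"
  have D: "?D \<in> events" using assms by simp
  have A: "?A \<in> events" using assms by simp
  obtain a b where ab: "V \<subseteq> {a..b}" "a \<le> b"
  proof (cases "V = {}")
    case False
    then show thesis
      using \<open>finite V\<close> by (intro that[of "Min V" "Max V"]) auto
  qed (use that[of 0 0] in auto)
  \<comment> \<open>The probability that a given vertex is touched during \<open>{0<..t}\<close>.\<close>
  define q where "q = 1 - exp (- t) ^ n"
  have q: "0 \<le> q" "q < 1"
    using \<open>0 < t\<close> by (auto simp: q_def power_le_one)
  have "(\<lambda>J. q ^ J) \<longlonglongrightarrow> 0"
    using q by (intro LIMSEQ_power_zero) auto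
  then obtain J where J: "q ^ J < \<epsilon> / 3"
    using order_tendstoD(2)[of "\<lambda>J. q ^ J" 0 sequentially "\<epsilon> / 3"] \<open>0 < \<epsilon>\<close>
    by (auto simp: eventually_sequentially)
  have far: "int n \<le> \<bar>int n * int i - int n * int j\<bar>" if "i < j" for i j :: nat
  proof -
    have "int n * int (Suc i) \<le> int n * int j"
      using that by (intro mult_left_mono) auto
    then show ?thesis by (simp add: algebra_simps)
  qed
  define fR where "fR j = b + int n * int j" for j
  define fL where "fL j = a - int n * int j" for j
  define BR where "BR = {\<omega> \<in> space M. \<forall>j<J. \<exists>y. fR j \<in> hyperedge n y \<and> count 0 t y \<omega> \<noteq> 0}"
  define BL where "BL = {\<omega> \<in> space M. \<forall>j<J. \<exists>y. fL j \<in> hyperedge n y \<and> count 0 t y \<omega> \<noteq> 0}"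
  have fR: "int n \<le> \<bar>fR i - fR j\<bar>" and fL: "int n \<le> \<bar>fL i - fL j\<bar>" if "i < j" for i j
    using far[OF that] by (auto simp: fR_def fL_def)
  have B: "BR \<in> events" "prob BR = q ^ J" "BL \<in> events" "prob BL = q ^ J"
    unfolding BR_def BL_def q_def
    by (rule prob_all_touched; use fR fL assms in blast)+
  define Y where "Y = {a - int n * int J - int n..b + int n * int J}"
  define c where "c = (real (card Y) * t)\<^sup>2"
  obtain k :: nat where k: "0 < k" "c / real k < \<epsilon> / 3"
  proof -
    obtain k :: nat where "3 * c / \<epsilon> < real k"
      using reals_Archimedean2 by blast
    moreover have "0 \<le> 3 * c / \<epsilon>" using \<open>0 < \<epsilon>\<close> by (simp add: c_def)
    ultimately have "0 < real k" by linarith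
    then show thesis
      using \<open>3 * c / \<epsilon> < real k\<close> \<open>0 < \<epsilon>\<close> by (intro that[of k]) (auto simp: field_simps)
  qed
  \<comment> \<open>Steps \<open>0, \<dots>, k - 1\<close> divide \<open>{0<..t}\<close> evenly; step \<open>k\<close> is the future interval \<open>{t<..t + h}\<close>.\<close>
  define g where "g i = (if i \<le> k then t * real i / real k else t + h)" for i
  have g0: "g 0 = 0" by (simp add: g_def)
  have gk: "g k = t" "g (Suc k) = t + h" using k by (auto simp: g_def)
  have gd: "g (Suc i) - g i = t / real k" if "i < k" for i
    using that k by (simp add: g_def field_simps)
  have g: "incseq g"
  proof (rule incseq_SucI)
    fix i
    consider "i < k" | "i = k" | "k < i" by linarith
    then show "g i \<le> g (Suc i)"
    proof cases
      case 1
      have "0 < t / real k" using k \<open>0 < t\<close> by simp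
      then show ?thesis using gd[OF 1] by linarith
    next
      case 2
      then show ?thesis using gk \<open>0 < h\<close> by simp
    next
      case 3
      then show ?thesis by (simp add: g_def)
    qed
  qed
  have gi: "0 \<le> g i" "g i \<le> g (Suc i)" for i
    using g g0 incseqD[OF g, of 0 i] by (auto simp: incseq_Suc_iff)
  define C where "C i = {\<omega> \<in> space M. 2 \<le> (\<Sum>y\<in>Y. count (g i) (g (Suc i)) y \<omega>)}" for i
  have Cev: "C i \<in> events" for i
    unfolding C_def using gi by (rule events_crowded)
  have C: "prob (C i) \<le> c / (real k)\<^sup>2" if "i < k" for i
  proof -
    have "g i < g (Suc i)"
    proof -
      have "0 < t / real k" using k \<open>0 < t\<close> by simp
      then show ?thesis using gd[OF that] by linarith
    qed
    then have "prob (C i) \<le> (real (card Y) * (1 * (g (Suc i) - g i)))\<^sup>2"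
      unfolding C_def using gi by (intro prob_crowded_le) (auto simp: Y_def)
    then show ?thesis
      by (simp add: gd[OF that] c_def power_divide)
  qed
  define N where "N = BR \<union> BL \<union> (\<Union>i<k. C i)"
  have Nev: "N \<in> events"
    unfolding N_def using B Cev by (intro sets.Un sets.finite_UN) auto
  have "prob N \<le> prob BR + prob BL + prob (\<Union>i<k. C i)"
  proof -
    have U: "(\<Union>i<k. C i) \<in> events" using Cev by (intro sets.finite_UN) auto
    have "prob N \<le> prob (BR \<union> BL) + prob (\<Union>i<k. C i)"
      unfolding N_def using B U by (intro measure_Un_le sets.Un)
    moreover have "prob (BR \<union> BL) \<le> prob BR + prob BL"
      using B by (intro measure_Un_le)
    ultimately show ?thesis by linarith
  qed
  also have "prob (\<Union>i<k. C i) \<le> (\<Sum>i<k. prob (C i))"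
    using Cev by (intro measure_UNION_le) auto
  also have "\<dots> \<le> (\<Sum>i<k. c / (real k)\<^sup>2)"
    by (intro sum_mono C) auto
  also have "\<dots> = c / real k"
    using k by (simp add: power2_eq_square)
  finally have N: "prob N \<le> \<epsilon>"
    using B J k by linarith
  define X where "X \<omega> p = count (g (snd p)) (g (Suc (snd p))) (fst p) \<omega>" for \<omega> p
  define E where "E = {\<omega> \<in> space M. mixed V (discretized n Y (X \<omega>) \<eta>\<^sub>0 k)}"
  have Y: "finite Y" by (simp add: Y_def)
  have X: "X \<omega> = (\<lambda>p. count (g (snd p)) (g (Suc (snd p))) (fst p) \<omega>)" for \<omega>
    by (rule ext) (simp add: X_def)
  have "0 \<le> g 0" by (simp add: g0)
  then have Eev: "E \<in> events" and "prob (E \<inter> {\<omega> \<in> space M. count (g k) (g (Suc k)) y \<omega> \<noteq> 0}) =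
      prob E * prob {\<omega> \<in> space M. count (g k) (g (Suc k)) y \<omega> \<noteq> 0}"
    unfolding E_def X by (rule discretized_event_indep[OF _ g Y])+
  then have ED: "prob (E \<inter> ?D) = prob E * prob ?D"
    by (simp only: gk)
  have AE: "AE \<omega> in M. \<omega> \<notin> N \<longrightarrow> (\<omega> \<in> ?A \<longleftrightarrow> \<omega> \<in> E)"
    using trajectory AE_space
  proof eventually_elim
    case (elim \<omega>)
    show ?case
    proof
      assume "\<omega> \<notin> N"
      then have "\<omega> \<notin> BR" "\<omega> \<notin> BL" and sparse: "\<And>i. i < k \<Longrightarrow> \<omega> \<notin> C i"
        by (auto simp: N_def)
      then obtain i j where i: "i < J" "\<And>y. fL i \<in> hyperedge n y \<Longrightarrow> count 0 t y \<omega> = 0"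
        and j: "j < J" "\<And>y. fR j \<in> hyperedge n y \<Longrightarrow> count 0 t y \<omega> = 0"
        using elim(2) unfolding BR_def BL_def by blast
      have le: "int n * int i \<le> int n * int J" "int n * int j \<le> int n * int J"
        using i j by (intro mult_left_mono; simp)+
      have "v \<in> discretized n Y (X \<omega>) \<eta>\<^sub>0 k \<longleftrightarrow> v \<in> \<eta> (g k) \<omega>" if "v \<in> V" for v
      proof (rule discretized_agrees[OF elim(1) g0 g, where l = "fL i" and r = "fR j" and k = k])
        show "finite (T y \<omega> \<inter> {0<..s})" for y s
          by (rule poisson_process.locally_finite[OF poisson elim(2)])
        show "T y \<omega> \<inter> {0<..g k} = {}" if "fL i \<in> hyperedge n y \<or> fR j \<in> hyperedge n y" for y
          using that i(2) j(2) poisson_process.arrivals_eq_0_iff[OF poisson elim(2) order_refl] gk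
          by metis
        show "finite Y" by (rule Y)
        show "{fL i - int n..fR j} \<subseteq> Y"
          using le by (auto simp: Y_def fL_def fR_def)
        show "X \<omega> (y, i) = card (T y \<omega> \<inter> {g i<..g (Suc i)})" for y i
          by (simp add: X_def arrivals_def)
        show "\<not> 2 \<le> (\<Sum>y\<in>Y. X \<omega> (y, i))" if "i < k" for i
          using sparse[OF that] elim(2) by (simp add: C_def X_def)
        have "a \<le> v" "v \<le> b" using ab(1) \<open>v \<in> V\<close> by auto
        moreover have "0 \<le> int n * int i" "0 \<le> int n * int j" by simp_all
        ultimately show "v \<in> {fL i..fR j}"
          unfolding fL_def fR_def atLeastAtMost_iff by linarith
      qed simp
      then show "\<omega> \<in> ?A \<longleftrightarrow> \<omega> \<in> E"
        using elim(2) mixed_cong[of V "discretized n Y (X \<omega>) \<eta>\<^sub>0 k" "\<eta> t \<omega>"] gk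
        by (simp add: E_def)
    qed
  qed
  have 1: "\<bar>prob ?A - prob E\<bar> \<le> \<epsilon>"
    using prob_diff_le_exceptional[OF A Eev Nev AE] N by linarith
  have "\<bar>prob (?A \<inter> ?D) - prob (E \<inter> ?D)\<bar> \<le> prob N"
    using A Eev Nev D AE by (intro prob_diff_le_exceptional) auto
  then show ?thesis
    using 1 N Eev ED by (intro bexI[of _ E]) auto
qed

text \<open>The approximating events are determined by increments of the clocks before \<open>t\<close>, so they are exactly
  independent of the later ring; the product formula survives the limit \<open>\<epsilon> \<rightarrow> 0\<close>.\<close>

lemma state_indep_future_ring:
  fixes y :: int
  assumes "0 < t" "0 < h" "0 < n" "finite V"
  defines "A \<equiv> {\<omega> \<in> space M. mixed V (\<eta> t \<omega>)}"
    and "D \<equiv> {\<omega> \<in> space M. count t (t + h) y \<omega> \<noteq> 0}"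
  shows "prob (A \<inter> D) = prob A * prob D"
proof -
  have "\<bar>prob (A \<inter> D) - prob A * prob D\<bar> \<le> 0"
  proof (rule field_le_epsilon)
    fix e :: real assume "0 < e"
    then obtain E where E: "\<bar>prob A - prob E\<bar> \<le> e / 2"
        "\<bar>prob (A \<inter> D) - prob (E \<inter> D)\<bar> \<le> e / 2" "prob (E \<inter> D) = prob E * prob D"
      using state_approximation[OF assms(1-4), of "e / 2" y] by (auto simp: A_def D_def)
    have "\<bar>prob E * prob D - prob A * prob D\<bar> = \<bar>prob A - prob E\<bar> * prob D"
      by (simp add: abs_mult flip: left_diff_distrib) (simp add: abs_minus_commute)
    also have "\<dots> \<le> e / 2 * 1"
      using E(1) \<open>0 < e\<close> by (intro mult_mono) auto
    finally show "\<bar>prob (A \<inter> D) - prob A * prob D\<bar> \<le> 0 + e"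
      using E(2,3) by linarith
  qed
  then show ?thesis by simp
qed

section \<open>The change of the mixing probability in a short time\<close>

text \<open>If the clocks near \<open>V\<close> ring at most once in total, the state on \<open>V\<close> is unchanged or results from a
  single update of the old state. The set \<open>Y\<close> also contains the hyperedges that meet a hyperedge meeting
  \<open>V\<close>, because the outcome of an update depends on vertices outside \<open>V\<close>.\<close>

lemma trajectory_update_sparse:
  assumes traj: "majority_rule_trajectory n (\<lambda>x. T x \<omega>) \<eta>\<^sub>0 (\<lambda>t. \<eta> t \<omega>)" and \<omega>: "\<omega> \<in> space M"
    and t: "0 \<le> t" "t \<le> u" and Y: "finite Y"
    and near: "\<forall>y z. hyperedge n y \<inter> V \<noteq> {} \<longrightarrow>
      hyperedge n z \<inter> (V \<union> hyperedge n y) \<noteq> {} \<longrightarrow> z \<in> Y"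
    and sparse: "\<not> 2 \<le> (\<Sum>y\<in>Y. count t u y \<omega>)"
  obtains "\<And>y. y \<in> Y \<Longrightarrow> count t u y \<omega> = 0" "mixed V (\<eta> u \<omega>) \<longleftrightarrow> mixed V (\<eta> t \<omega>)"
    | y where "y \<in> Y" "\<And>z. z \<in> Y \<Longrightarrow> count t u z \<omega> \<noteq> 0 \<longleftrightarrow> z = y"
        "mixed V (\<eta> u \<omega>) \<longleftrightarrow> mixed V (majority_update n y (\<eta> t \<omega>))"
proof -
  have zero: "T z \<omega> \<inter> {t<..u} = {}" if "count t u z \<omega> = 0" for z
    using that poisson_process.arrivals_eq_0_iff[OF poisson \<omega> t(1)] by simp
  have near': "z \<in> Y" if "v \<in> V" "v \<in> hyperedge n z" for v z
    using near[rule_format, of z z] that by auto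
  have steady: "v \<in> \<eta> u \<omega> \<longleftrightarrow> v \<in> \<eta> t \<omega>"
    if "v \<in> V" "\<And>z. z \<in> Y \<Longrightarrow> v \<in> hyperedge n z \<Longrightarrow> count t u z \<omega> = 0" for v
  proof (rule trajectory_constant[OF traj t])
    show "T z \<omega> \<inter> {t<..u} = {}" if "v \<in> hyperedge n z" for z
      using zero near' that \<open>v \<in> V\<close> \<open>\<And>z. z \<in> Y \<Longrightarrow> v \<in> hyperedge n z \<Longrightarrow> count t u z \<omega> = 0\<close>
      by blast
  qed
  from Y sparse show thesis
  proof (cases rule: sum_less_two_cases)
    case 1
    then show thesis
      using mixed_cong[of V "\<eta> u \<omega>" "\<eta> t \<omega>"] steady by (intro that(1)) auto
  next
    case (2 y)
    have "mixed V (\<eta> u \<omega>) \<longleftrightarrow> mixed V (majority_update n y (\<eta> t \<omega>))"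
    proof (rule mixed_cong)
      fix v assume "v \<in> V"
      show "v \<in> \<eta> u \<omega> \<longleftrightarrow> v \<in> majority_update n y (\<eta> t \<omega>)"
      proof (cases "hyperedge n y \<inter> V = {}")
        case True
        then have "v \<notin> hyperedge n y" using \<open>v \<in> V\<close> by auto
        moreover from this have "v \<in> \<eta> u \<omega> \<longleftrightarrow> v \<in> \<eta> t \<omega>"
          using steady[OF \<open>v \<in> V\<close>] 2(3) by metis
        ultimately show ?thesis by (simp add: majority_update_outside)
      next
        case False
        show ?thesis
        proof (rule trajectory_single_ring[OF traj t(1), where V = "V \<union> hyperedge n y"])
          show "card (T y \<omega> \<inter> {t<..u}) = 1"
            using 2(2) by (simp add: arrivals_def)
          show "T z \<omega> \<inter> {t<..u} = {}" if "z \<noteq> y" "hyperedge n z \<inter> (V \<union> hyperedge n y) \<noteq> {}" for z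
            using near[rule_format, OF False that(2)] 2(3) that(1) by (intro zero) auto
        qed (use \<open>v \<in> V\<close> in auto)
      qed
    qed
    moreover have "count t u z \<omega> \<noteq> 0 \<longleftrightarrow> z = y" if "z \<in> Y" for z
      using 2(2) 2(3)[OF that] by (cases "z = y") auto
    ultimately show thesis
      using 2(1) by (intro that(2)[of y])
  qed
qed

definition mix_prob :: "int set \<Rightarrow> real \<Rightarrow> real" where
  "mix_prob V t = prob {\<omega> \<in> space M. mixed V (\<eta> t \<omega>)}"

text \<open>Here \<open>R\<close> consists of the hyperedges whose ring replaces the question whether \<open>V\<close> is mixed by the same
  question for another set \<open>P y\<close>. Each of them rings with probability \<open>q\<close>, independently of the state at
  time \<open>t\<close>; two or more rings near \<open>V\<close> contribute to the error term.\<close>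

lemma mix_prob_one_step:
  assumes "0 < t" "0 < h" "0 < n" "finite V" "finite Y" "R \<subseteq> Y"
    and near: "\<forall>y z. hyperedge n y \<inter> V \<noteq> {} \<longrightarrow>
      hyperedge n z \<inter> (V \<union> hyperedge n y) \<noteq> {} \<longrightarrow> z \<in> Y"
    and P: "\<And>y. finite (P y)"
    and pre: "\<And>y \<zeta>. y \<in> R \<Longrightarrow> mixed V (majority_update n y \<zeta>) \<Longrightarrow> mixed (P y) \<zeta>"
    and other: "\<And>y \<zeta>. y \<notin> R \<Longrightarrow> mixed V (majority_update n y \<zeta>) \<Longrightarrow> mixed V \<zeta>"
  defines "q \<equiv> 1 - exp (- h)"
  shows "mix_prob V (t + h) \<le> (1 + real (card R)) * (real (card Y) * h)\<^sup>2 +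
    (1 - real (card R) * q) * mix_prob V t + q * (\<Sum>y\<in>R. mix_prob (P y) t)"
proof -
  define A where "A W s = {\<omega> \<in> space M. mixed W (\<eta> s \<omega>)}" for W s
  define D where "D y = {\<omega> \<in> space M. count t (t + h) y \<omega> \<noteq> 0}" for y
  define C where "C = {\<omega> \<in> space M. 2 \<le> (\<Sum>y\<in>Y. count t (t + h) y \<omega>)}"
  have R: "finite R" using assms finite_subset by blast
  have Aev: "A W s \<in> events" if "0 \<le> s" "finite W" for W s
    unfolding A_def using that by (rule events_mixed)
  have Dev: "D y \<in> events" for y
    unfolding D_def using assms by (intro events_count) auto
  have Cev: "C \<in> events"
    unfolding C_def using assms by (intro events_crowded) auto
  have V: "A V t \<in> events" "A V (t + h) \<in> events" and PA: "A (P y) t \<in> events" for y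
    using assms by (auto intro!: Aev)
  have Dq: "prob (D y) = q" for y
    using poisson_process.prob_some_arrival[OF poisson, of t "t + h" y] assms(1,2)
    by (simp add: D_def q_def)
  have AD: "prob (A W t \<inter> D y) = prob (A W t) * q" if "finite W" for W y
    using state_indep_future_ring[OF assms(1-3) that, of y] Dq[of y] by (simp add: A_def D_def)
  \<comment> \<open>If at most one clock of \<open>Y\<close> rings, the two sums exchange \<open>A V t\<close> for \<open>A (P y) t\<close> exactly when
      some \<open>y \<in> R\<close> rings. On the crowded event \<open>C\<close> the first sum may be as large as \<open>card R\<close>, which
      the coefficient of \<open>C\<close> compensates.\<close>
  let ?g = "\<lambda>\<omega>. (1 + real (card R)) * indicator C \<omega> + indicator (A V t) \<omega>
      - (\<Sum>y\<in>R. indicator (A V t \<inter> D y) \<omega>) + (\<Sum>y\<in>R. indicator (A (P y) t \<inter> D y) \<omega>) :: real"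
  have "AE \<omega> in M. indicator (A V (t + h)) \<omega> \<le> ?g \<omega>"
    using trajectory AE_space
  proof eventually_elim
    case (elim \<omega>)
    let ?d = "\<lambda>y. indicator (D y) \<omega> :: real"
    show ?case
    proof (cases "\<omega> \<in> C")
      case True
      have "(\<Sum>y\<in>R. indicator (A V t \<inter> D y) \<omega>) \<le> (\<Sum>y\<in>R. 1 :: real)"
        by (intro sum_mono) (simp add: indicator_def)
      then have "(\<Sum>y\<in>R. indicator (A V t \<inter> D y) \<omega>) \<le> real (card R)"
        by simp
      moreover have "0 \<le> (\<Sum>y\<in>R. indicator (A (P y) t \<inter> D y) \<omega> :: real)"
        by (intro sum_nonneg) simp
      moreover have "indicator (A V (t + h)) \<omega> \<le> (1 :: real)" "(0 :: real) \<le> indicator (A V t) \<omega>"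
        by (simp_all add: indicator_def)
      moreover have "a \<le> (1 + c) * 1 + b - s + s'"
        if "s \<le> c" "0 \<le> s'" "a \<le> 1" "0 \<le> b" for a b c s s' :: real
        using that by simp
      ultimately show ?thesis
        unfolding indicator_simps(1)[OF True] by blast
    next
      case False
      then have sparse: "\<not> 2 \<le> (\<Sum>y\<in>Y. count t (t + h) y \<omega>)"
        using elim(2) by (simp add: C_def)
      have t: "0 \<le> t" "t \<le> t + h" using assms by auto
      from elim(1,2) t assms(5) near sparse show ?thesis
      proof (cases rule: trajectory_update_sparse)
        case 1
        then have d: "\<omega> \<notin> D y" if "y \<in> R" for y
          using that assms(6) by (auto simp: D_def)
        have "(\<Sum>y\<in>R. indicator (A V t \<inter> D y) \<omega> :: real) = 0"
          "(\<Sum>y\<in>R. indicator (A (P y) t \<inter> D y) \<omega> :: real) = 0"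
          using d by (auto intro!: sum.neutral)
        moreover have "indicator (A V (t + h)) \<omega> = (indicator (A V t) \<omega> :: real)"
          using 1(2) by (simp add: A_def indicator_def)
        ultimately show ?thesis using False by simp
      next
        case (2 y)
        have d: "\<omega> \<in> D z \<longleftrightarrow> z = y" if "z \<in> R" for z
          using that assms(6) 2(2)[of z] elim(2) by (auto simp: D_def)
        have sum_d: "(\<Sum>z\<in>R. indicator (F z \<inter> D z) \<omega> :: real) =
            (if y \<in> R then indicator (F y) \<omega> else 0)" for F
        proof -
          have "(\<Sum>z\<in>R. indicator (F z \<inter> D z) \<omega> :: real) =
              (\<Sum>z\<in>R. if z = y then indicator (F z) \<omega> else 0)"
            using d by (intro sum.cong) (auto simp: indicator_def)
          then show ?thesis using R by simp
        qed
        show ?thesis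
        proof (cases "y \<in> R")
          case True
          then have "mixed V (\<eta> (t + h) \<omega>) \<Longrightarrow> mixed (P y) (\<eta> t \<omega>)"
            using 2(3) pre by simp
          then show ?thesis
            using True \<open>\<omega> \<notin> C\<close> sum_d[of "\<lambda>_. A V t"] sum_d[of "\<lambda>z. A (P z) t"]
            by (auto simp: A_def indicator_def)
        next
          case False
          then have "mixed V (\<eta> (t + h) \<omega>) \<Longrightarrow> mixed V (\<eta> t \<omega>)"
            using 2(3) other by simp
          then show ?thesis
            using False \<open>\<omega> \<notin> C\<close> sum_d[of "\<lambda>_. A V t"] sum_d[of "\<lambda>z. A (P z) t"]
            by (auto simp: A_def indicator_def)
        qed
      qed
    qed
  qed
  moreover have int: "integrable M (indicator S :: _ \<Rightarrow> real)" if "S \<in> events" for S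
    using that by (intro integrable_real_indicator) (simp_all add: emeasure_eq_measure)
  have g: "integrable M ?g"
    using V Cev PA Dev by (intro Bochner_Integration.integrable_add Bochner_Integration.integrable_diff
        Bochner_Integration.integrable_sum integrable_mult_right int sets.Int)
  ultimately have "integral\<^sup>L M (indicator (A V (t + h))) \<le> integral\<^sup>L M ?g"
    using V int by (intro integral_mono_AE) auto
  then have "prob (A V (t + h)) \<le> integral\<^sup>L M ?g"
    using V by simp
  also have "integral\<^sup>L M ?g = (1 + real (card R)) * prob C + prob (A V t)
      - (\<Sum>y\<in>R. prob (A V t \<inter> D y)) + (\<Sum>y\<in>R. prob (A (P y) t \<inter> D y))"
  proof -
    have S: "A V t \<inter> D y \<in> events" "A (P y) t \<inter> D y \<in> events" for y
      using V PA Dev by auto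
    have I: "integral\<^sup>L M (indicator S :: _ \<Rightarrow> real) = prob S" if "S \<in> events" for S
      using that by simp
    show ?thesis
      using V Cev S
      by (simp add: Bochner_Integration.integral_add Bochner_Integration.integral_diff
          Bochner_Integration.integral_sum Bochner_Integration.integrable_add
          Bochner_Integration.integrable_diff Bochner_Integration.integrable_sum I int)
  qed
  also have "\<dots> = (1 + real (card R)) * prob C + (1 - real (card R) * q) * prob (A V t)
      + q * (\<Sum>y\<in>R. prob (A (P y) t))"
    using AD[OF assms(4)] AD[OF P] by (simp add: algebra_simps sum_distrib_left)
  also have "prob C \<le> (real (card Y) * (1 * (t + h - t)))\<^sup>2"
    unfolding C_def using assms by (intro prob_crowded_le) auto
  finally show ?thesis
    by (simp add: mix_prob_def A_def mult_left_mono)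
qed

end

section \<open>A maximum principle for window lengths\<close>

text \<open>The hypothesis \<open>sub\<close> says that \<open>m\<close> is subharmonic for a walk on the lengths that jumps from \<open>L\<close> to
  \<open>L + r + 1 - i\<close> at rate \<open>2\<close> for \<open>1 \<le> i \<le> min L n\<close> and, when \<open>L < n\<close>, to \<open>0\<close> at rate \<open>n - L\<close>. Linear
  functions are harmonic for this walk, also near \<open>0\<close>. After subtraction of a line of small slope, \<open>m\<close> has a
  maximum; a positive maximum at its smallest location contradicts subharmonicity, since the walk can move
  to a smaller length from there.\<close>

lemma bounded_subharmonic_eq_0:
  fixes m :: "nat \<Rightarrow> real"
  assumes n: "n = 2 * r + 1" "0 < r"
    and m: "\<And>L. m L \<le> 1" "m 0 = 0"
    and sub: "\<And>L. 1 \<le> L \<Longrightarrow>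
      real (2 * min L n + (n - L)) * m L \<le> 2 * (\<Sum>i = 1..min L n. m (L + r + 1 - i))"
  shows "m L \<le> 0"
proof (rule ccontr)
  assume "\<not> m L \<le> 0"
  then have "0 < m L" by simp
  then have "L \<noteq> 0" using m(2) by (cases L) auto
  \<comment> \<open>A slope small enough that \<open>m\<close> stays above the line at \<open>L\<close>.\<close>
  define e where "e = m L / (2 * real L)"
  have "0 < e" using \<open>0 < m L\<close> \<open>L \<noteq> 0\<close> by (simp add: e_def)
  define f where "f k = m k - e * real k" for k
  have "0 < f L" using \<open>0 < m L\<close> \<open>L \<noteq> 0\<close> by (simp add: f_def e_def)
  define S where "S = {k. 0 < f k}"
  have "S \<subseteq> {..nat \<lceil>1 / e\<rceil>}"
  proof
    fix k assume "k \<in> S"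
    then have "e * real k < 1" using m(1)[of k] by (simp add: S_def f_def)
    then have "real k < 1 / e" using \<open>0 < e\<close> by (simp add: field_simps)
    then show "k \<in> {..nat \<lceil>1 / e\<rceil>}" by simp linarith
  qed
  then have "finite S" by (rule finite_subset) simp
  define F where "F = Max (f ` S)"
  have "L \<in> S" using \<open>0 < f L\<close> by (simp add: S_def)
  have "F \<in> f ` S" unfolding F_def using \<open>finite S\<close> \<open>L \<in> S\<close> by (intro Max_in) auto
  then have ex: "\<exists>k. f k = F" by auto
  have "0 < F" using \<open>F \<in> f ` S\<close> by (auto simp: S_def)
  have le: "f k \<le> F" for k
  proof (cases "k \<in> S")
    case True
    then show ?thesis unfolding F_def using \<open>finite S\<close> by (intro Max_ge) auto
  qed (use \<open>0 < F\<close> in \<open>auto simp: S_def\<close>)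
  define K where "K = (LEAST k. f k = F)"
  have FK: "f K = F" unfolding K_def using ex by (rule LeastI_ex)
  have less: "f k < F" if "k < K" for k
    using not_less_Least[of k "\<lambda>k. f k = F"] that le[of k] by (auto simp: K_def)
  have "1 \<le> K" using FK \<open>0 < F\<close> m(2) by (cases K) (auto simp: f_def)
  \<comment> \<open>With \<open>j = min K n\<close> this is harmonicity of the identity.\<close>
  have lin: "2 * (\<Sum>i = 1..j. real (K + r + 1 - i)) = real j * (2 * real K + real n - real j)"
    if "j \<le> K" for j
    using that
  proof (induction j)
    case (Suc j)
    then have "real (K + r + 1 - Suc j) = real K + real r - real j" by (simp add: of_nat_diff)
    then show ?case using Suc n(1) by (simp add: algebra_simps)
  qed simp
  have "real (2 * min K n + (n - K)) * real K = 2 * (\<Sum>i = 1..min K n. real (K + r + 1 - i))"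
    unfolding lin[OF min.cobounded1] by (cases "K \<le> n") (auto simp: of_nat_diff algebra_simps)
  then have "real (2 * min K n + (n - K)) * (e * real K) =
      2 * (\<Sum>i = 1..min K n. e * real (K + r + 1 - i))"
    by (simp add: mult.left_commute flip: sum_distrib_left)
  then have *: "real (2 * min K n + (n - K)) * F \<le> 2 * (\<Sum>i = 1..min K n. f (K + r + 1 - i))"
    using sub[OF \<open>1 \<le> K\<close>] unfolding FK[symmetric] f_def
    by (simp add: sum_subtractf right_diff_distrib)
  show False
  proof (cases "K < n")
    case True
    have "(\<Sum>i = 1..K. f (K + r + 1 - i)) \<le> (\<Sum>i = 1..K. F)"
      by (intro sum_mono le)
    then have "real (2 * K + (n - K)) * F \<le> real (2 * K) * F"
      using * True by simp
    then show False using \<open>0 < F\<close> True by simp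
  next
    case False
    have "(\<Sum>i = 1..n. f (K + r + 1 - i)) < (\<Sum>i = 1..n. F)"
    proof (rule sum_strict_mono_ex1)
      show "\<exists>i\<in>{1..n}. f (K + r + 1 - i) < F"
        \<comment> \<open>The jump from \<open>K\<close> to \<open>K - 1\<close>.\<close>
        using n False by (intro bexI[of _ "r + 2"] less) auto
    qed (auto intro: le)
    then show False
      using * False by simp
  qed
qed

context majority_rule_model
begin

section \<open>Decay of the mixing probability\<close>

text \<open>The supremum over time makes \<open>peak L\<close> a decreasing sequence, so that its limit exists; the supremum
  over space replaces the missing translation invariance of the initial configuration. Times start at
  \<open>real k + 1\<close> to keep them positive.\<close>

definition peak :: "nat \<Rightarrow> nat \<Rightarrow> real" where
  "peak L k = (SUP p\<in>UNIV \<times> {real k + 1..}. mix_prob (window (fst p) L) (snd p))"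

lemma mix_prob_bounds: "0 \<le> mix_prob V t" "mix_prob V t \<le> 1"
  by (simp_all add: mix_prob_def)

lemma mix_prob_le_peak:
  assumes "real k + 1 \<le> t"
  shows "mix_prob (window x L) t \<le> peak L k"
proof -
  have "bdd_above ((\<lambda>p. mix_prob (window (fst p) L) (snd p)) ` (UNIV \<times> {real k + 1..}))"
    by (rule bdd_aboveI[of _ 1]) (auto simp: mix_prob_bounds)
  from cSUP_upper[OF _ this, of "(x, t)"] assms show ?thesis
    by (simp add: peak_def)
qed

lemma peak_leI:
  assumes "\<And>x t. real k + 1 \<le> t \<Longrightarrow> mix_prob (window x L) t \<le> b"
  shows "peak L k \<le> b"
  unfolding peak_def
proof (rule cSUP_least)
  show "(UNIV \<times> {real k + 1..} :: (int \<times> real) set) \<noteq> {}"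
    by (auto intro: exI[of _ "real k + 1"])
qed (use assms in auto)

lemma peak_bounds: "0 \<le> peak L k" "peak L k \<le> 1"
  using mix_prob_le_peak[of k "real k + 1" 0 L] mix_prob_bounds(1)[of "window 0 L" "real k + 1"]
  by (auto intro: peak_leI mix_prob_bounds)

lemma decseq_peak: "decseq (peak L)"
  by (rule decseq_SucI, rule peak_leI, rule mix_prob_le_peak) simp

lemma peak_0: "peak 0 k = 0"
proof (rule antisym)
  show "peak 0 k \<le> 0"
    by (rule peak_leI) (simp add: mix_prob_def mixed_window_0)
qed (rule peak_bounds)

text \<open>The geometry of all hyperedges near a window is collected here. With \<open>j = min L n\<close>, \<open>RL\<close> and \<open>RR\<close> are the
  hyperedges that meet the window in its first and in its last \<open>i\<close> vertices, \<open>1 \<le> i \<le> j\<close>, and \<open>RC\<close> those that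
  cover it. All others lie inside the window or are disjoint from it.\<close>

lemma peak_step:
  assumes n: "n = 2 * r + 1" and L: "1 \<le> L" and h: "0 < h"
  defines "c \<equiv> 2 * min L n + (n - L)" and "q \<equiv> 1 - exp (- h)"
  assumes cq: "real c * q \<le> 1" and t: "real k + 1 \<le> t"
  shows "mix_prob (window x L) (t + h) \<le> (1 + real c) * (real (L + 3 * n + 1) * h)\<^sup>2 +
    (1 - real c * q) * peak L k + q * (2 * (\<Sum>i = 1..min L n. peak (L + r + 1 - i) k))"
proof -
  define j where "j = min L n"
  define RL where "RL = {x - int n + 1..x - int n + int j}"
  define RR where "RR = {x + int L + 1 - int j..x + int L}"
  define RC where "RC = {x + int L - int n + 1..x}"
  define R where "R = RL \<union> RR \<union> RC"
  \<comment> \<open>Window that must be mixed before a ring of \<open>y\<close>: it starts at \<open>st y\<close> and has \<open>len y\<close> edges. For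
      \<open>y \<in> RC\<close> it is a single vertex, which is never mixed.\<close>
  define len where "len y = (if y \<in> RL then nat (x + int L - y - int r)
    else if y \<in> RR then nat (y + int r - x) else 0)" for y
  define st where "st y = (if y \<in> RL then y + int r else x)" for y
  define Y where "Y = {x - 2 * int n..x + int L + int n}"
  have fin: "finite RL" "finite RR" "finite RC" by (auto simp: RL_def RR_def RC_def)
  have disj: "RL \<inter> RR = {}" "(RL \<union> RR) \<inter> RC = {}"
    unfolding RL_def RR_def RC_def j_def by auto
  have cR: "card R = c"
  proof -
    have "card RL = j" "card RR = j" "card RC = n - L"
      by (auto simp: RL_def RR_def RC_def)
    then show ?thesis
      unfolding R_def using fin disj by (simp add: card_Un_disjoint c_def j_def)
  qed
  have cY: "card Y = L + 3 * n + 1" by (simp add: Y_def)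
  have "mix_prob (window x L) (t + h) \<le> (1 + real (card R)) * (real (card Y) * h)\<^sup>2 +
    (1 - real (card R) * (1 - exp (- h))) * mix_prob (window x L) t
      + (1 - exp (- h)) * (\<Sum>y\<in>R. mix_prob (window (st y) (len y)) t)"
  proof (rule mix_prob_one_step)
    show "0 < t" "0 < h" "0 < n" using t h n by auto
    show "finite (window x L)" "finite Y" "finite (window (st y) (len y))" for y
      by (simp_all add: window_def Y_def)
    show "R \<subseteq> Y"
      by (auto simp: R_def Y_def RL_def RR_def RC_def j_def)
    show "\<forall>y z. hyperedge n y \<inter> window x L \<noteq> {} \<longrightarrow>
        hyperedge n z \<inter> (window x L \<union> hyperedge n y) \<noteq> {} \<longrightarrow> z \<in> Y"
      by (auto simp: hyperedge_def window_def Y_def)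
    show "mixed (window (st y) (len y)) \<zeta>"
      if "y \<in> R" and mix: "mixed (window x L) (majority_update n y \<zeta>)" for y \<zeta>
    proof -
      consider "y \<in> RL" | "y \<in> RR" "y \<notin> RL" | "y \<in> RC"
        using \<open>y \<in> R\<close> by (auto simp: R_def)
      then show ?thesis
      proof cases
        case 1
        define i where "i = nat (y - x + int n)"
        have i: "y = x - int n + int i" "1 \<le> i" "i \<le> j"
          using 1 by (auto simp: i_def RL_def)
        have "mixed (window (x + int i - 1 - int r) (L + r + 1 - i)) \<zeta>"
          using mix i by (intro mixed_update_left) (auto simp: n j_def)
        moreover have "st y = x + int i - 1 - int r" "len y = L + r + 1 - i"
          using 1 i by (auto simp: st_def len_def n j_def)
        ultimately show ?thesis by simp
      next
        case 2
        define i where "i = nat (x + int L + 1 - y)"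
        have i: "y = x + int L + 1 - int i" "1 \<le> i" "i \<le> j"
          using 2 by (auto simp: i_def RR_def)
        have "mixed (window x (L + r + 1 - i)) \<zeta>"
          using mix i by (intro mixed_update_right) (auto simp: n j_def)
        moreover have "st y = x" "len y = L + r + 1 - i"
          using 2 i by (auto simp: st_def len_def n j_def)
        ultimately show ?thesis by simp
      next
        case 3
        then have "window x L \<subseteq> hyperedge n y"
          by (auto simp: RC_def window_def hyperedge_def)
        then show ?thesis using mix not_mixed_update_covered by blast
      qed
    qed
    show "mixed (window x L) \<zeta>"
      if "y \<notin> R" and mix: "mixed (window x L) (majority_update n y \<zeta>)" for y \<zeta>
    proof (rule mixed_update_inner_or_disjoint[OF _ _ mix])
      have "y \<notin> RL" "y \<notin> RR" "y \<notin> RC" using \<open>y \<notin> R\<close> by (auto simp: R_def)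
      then have "y \<le> x - int n \<or> x + int L < y \<or> x < y \<and> y + int n \<le> x + int L + 1"
        unfolding RL_def RR_def RC_def j_def by (cases "L \<le> n") auto
      then show "hyperedge n y \<subseteq> window x L \<or> hyperedge n y \<inter> window x L = {}"
        by (auto simp: hyperedge_def window_def)
    qed (use n in simp)
  qed
  also have "(\<Sum>y\<in>R. mix_prob (window (st y) (len y)) t) \<le> (\<Sum>y\<in>R. peak (len y) k)"
    by (intro sum_mono mix_prob_le_peak t)
  also have "(\<Sum>y\<in>R. peak (len y) k) = 2 * (\<Sum>i = 1..j. peak (L + r + 1 - i) k)"
  proof -
    have "(\<Sum>y\<in>R. peak (len y) k) = (\<Sum>y\<in>RL. peak (len y) k) + (\<Sum>y\<in>RR. peak (len y) k)
        + (\<Sum>y\<in>RC. peak (len y) k)"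
      unfolding R_def using fin disj by (simp add: sum.union_disjoint)
    also have "(\<Sum>y\<in>RL. peak (len y) k) = (\<Sum>i = 1..j. peak (L + r + 1 - i) k)"
      by (rule sum.reindex_bij_witness[where i = "\<lambda>i. x - int n + int i"
            and j = "\<lambda>y. nat (y - x + int n)"])
        (auto simp: RL_def len_def n j_def intro!: arg_cong2[where f = peak])
    also have "(\<Sum>y\<in>RR. peak (len y) k) = (\<Sum>i = 1..j. peak (L + r + 1 - i) k)"
    proof (rule sum.reindex_bij_witness[where i = "\<lambda>i. x + int L + 1 - int i"
            and j = "\<lambda>y. nat (x + int L + 1 - y)"])
      fix y assume "y \<in> RR"
      moreover from this have "y \<notin> RL" using disj by auto
      ultimately show "peak (L + r + 1 - nat (x + int L + 1 - y)) k = peak (len y) k"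
        by (auto simp: len_def RR_def n j_def intro!: arg_cong2[where f = peak])
    qed (auto simp: RR_def j_def)
    also have "(\<Sum>y\<in>RC. peak (len y) k) = 0"
      using disj by (intro sum.neutral) (auto simp: len_def peak_0)
    finally show ?thesis by simp
  qed
  also have "mix_prob (window x L) t \<le> peak L k"
    by (rule mix_prob_le_peak[OF t])
  finally show ?thesis
    using cq h unfolding cR cY q_def j_def by (simp add: mult_left_mono)
qed

definition limit_peak :: "nat \<Rightarrow> real" where
  "limit_peak L = lim (peak L)"

lemma tendsto_limit_peak: "peak L \<longlonglongrightarrow> limit_peak L"
proof -
  obtain l where "peak L \<longlonglongrightarrow> l"
    by (rule decseq_convergent[OF decseq_peak]) (use peak_bounds(1) in blast)
  then have "convergent (peak L)"
    by (rule convergentI)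
  then show ?thesis
    by (simp add: limit_peak_def convergent_LIMSEQ_iff)
qed

text \<open>In \<open>peak_step\<close> the time step \<open>h\<close> is fixed while \<open>k \<rightarrow> \<infinity>\<close>, so the unknown \<open>limit_peak L\<close> appears on
  both sides and can be isolated. The error is of order \<open>h\<^sup>2\<close>, against \<open>q\<close> of order \<open>h\<close>, and disappears as
  \<open>h \<rightarrow> 0\<close>.\<close>

lemma limit_peak_subharmonic:
  assumes n: "n = 2 * r + 1" and L: "1 \<le> L"
  shows "real (2 * min L n + (n - L)) * limit_peak L \<le>
    2 * (\<Sum>i = 1..min L n. limit_peak (L + r + 1 - i))" (is "_ \<le> 2 * ?S")
proof (rule field_le_epsilon)
  define c where "c = 2 * min L n + (n - L)"
  fix e :: real assume "0 < e"
  define B where "B = (1 + real c) * (real (L + 3 * n + 1))\<^sup>2"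
  have "0 < B" by (simp add: B_def add_pos_nonneg)
  have "1 \<le> c" using L n by (simp add: c_def min_def)
  \<comment> \<open>The first bound keeps \<open>1 - real c * q\<close> nonnegative, the second makes the error at most \<open>e\<close>.\<close>
  define h where "h = min (1 / real c) (e / (2 * B))"
  have "0 < h"
    using \<open>0 < e\<close> \<open>0 < B\<close> \<open>1 \<le> c\<close> by (simp add: h_def)
  have "h \<le> 1 / real c" "h \<le> e / (2 * B)"
    by (simp_all add: h_def)
  then have "h * real c \<le> 1" "2 * B * h \<le> e"
    using \<open>0 < B\<close> \<open>1 \<le> c\<close> by (simp_all add: field_simps)
  have "h * 1 \<le> h * real c"
    using \<open>1 \<le> c\<close> \<open>0 < h\<close> by (intro mult_left_mono) auto
  then have "h \<le> 1"
    using \<open>h * real c \<le> 1\<close> by linarith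
  define q where "q = 1 - exp (- h)"
  have "q \<le> h" using exp_ge_add_one_self[of "- h"] by (simp add: q_def)
  then have "real c * q \<le> 1"
    using \<open>h * real c \<le> 1\<close> mult_left_mono[of q h "real c"] by (simp add: mult.commute)
  have "h \<le> 2 * q"
  proof -
    have "exp (- h) \<le> 1 / (1 + h)"
      using exp_ge_add_one_self[of h] \<open>0 < h\<close> by (simp add: exp_minus field_simps)
    also have "\<dots> \<le> 1 - h / 2"
      using \<open>0 < h\<close> \<open>h \<le> 1\<close> by (simp add: field_simps)
    finally show ?thesis by (simp add: q_def)
  qed
  then have "0 < q" using \<open>0 < h\<close> by simp
  have "limit_peak L \<le> B * h\<^sup>2 + (1 - real c * q) * peak L k
      + q * (2 * (\<Sum>i = 1..min L n. peak (L + r + 1 - i) k))" (is "_ \<le> ?rhs k") for k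
  proof -
    have "limit_peak L \<le> peak L (k + 1)"
      using decseq_ge[OF decseq_peak tendsto_limit_peak] .
    also have "\<dots> \<le> ?rhs k"
    proof (rule peak_leI)
      fix x t assume "real (k + 1) + 1 \<le> t"
      then have "real k + 1 \<le> t - h" using \<open>h \<le> 1\<close> by simp
      from peak_step[OF n L \<open>0 < h\<close> _ this, of x, folded c_def q_def] \<open>real c * q \<le> 1\<close>
      show "mix_prob (window x L) t \<le> ?rhs k"
        by (simp add: B_def power_mult_distrib mult.assoc)
    qed
    finally show ?thesis .
  qed
  moreover have "?rhs \<longlonglongrightarrow> B * h\<^sup>2 + (1 - real c * q) * limit_peak L + q * (2 * ?S)"
    by (intro tendsto_intros tendsto_limit_peak)
  ultimately have "limit_peak L \<le> B * h\<^sup>2 + (1 - real c * q) * limit_peak L + q * (2 * ?S)"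
    by (intro LIMSEQ_le_const) auto
  then have "q * (real c * limit_peak L) \<le> B * h * h + q * (2 * ?S)"
    by (simp add: algebra_simps power2_eq_square)
  also have "B * h * h \<le> B * h * (2 * q)"
    using \<open>h \<le> 2 * q\<close> \<open>0 < h\<close> \<open>0 < B\<close> by (intro mult_left_mono) auto
  also have "\<dots> \<le> q * e"
    using mult_left_mono[OF \<open>2 * B * h \<le> e\<close>, of q] \<open>0 < q\<close> by (simp add: mult_ac)
  finally have "q * (real c * limit_peak L) \<le> q * (2 * ?S + e)"
    by (simp add: algebra_simps)
  then have "real c * limit_peak L \<le> 2 * ?S + e"
    using \<open>0 < q\<close> by (rule mult_left_le_imp_le)
  then show "real (2 * min L n + (n - L)) * limit_peak L \<le> 2 * ?S + e"
    by (simp only: c_def)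
qed

lemma limit_peak_eq_0:
  assumes "odd n" "1 < n"
  shows "limit_peak L = 0"
proof -
  obtain r where n: "n = 2 * r + 1"
    using \<open>odd n\<close> by (rule oddE)
  have "limit_peak L \<le> 0"
  proof (rule bounded_subharmonic_eq_0[OF n])
    show "0 < r" using \<open>1 < n\<close> n by simp
    show "limit_peak L \<le> 1" for L
      by (rule LIMSEQ_le_const2[OF tendsto_limit_peak]) (use peak_bounds(2) in blast)
    show "limit_peak 0 = 0"
    proof (rule LIMSEQ_unique[OF tendsto_limit_peak])
      have "peak 0 = (\<lambda>_. 0)" by (rule ext) (rule peak_0)
      then show "peak 0 \<longlonglongrightarrow> 0" by simp
    qed
  qed (rule limit_peak_subharmonic[OF n])
  moreover have "0 \<le> limit_peak L"
    by (rule LIMSEQ_le_const[OF tendsto_limit_peak]) (use peak_bounds(1) in blast)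
  ultimately show ?thesis by simp
qed

lemma mix_prob_tendsto_0:
  assumes "odd n" "1 < n"
  shows "((\<lambda>t. mix_prob (window x L) t) \<longlongrightarrow> 0) at_top"
proof (rule order_tendstoI)
  fix a :: real assume "a < 0"
  then show "\<forall>\<^sub>F t in at_top. a < mix_prob (window x L) t"
    by (intro always_eventually allI less_le_trans[OF _ mix_prob_bounds(1)])
next
  fix a :: real assume "0 < a"
  then have "\<forall>\<^sub>F k in sequentially. peak L k < a"
    using tendsto_limit_peak[of L] limit_peak_eq_0[OF assms, of L]
    by (intro order_tendstoD(2)[of _ 0]) simp_all
  then obtain k where "peak L k < a"
    by (auto simp: eventually_sequentially)
  then show "\<forall>\<^sub>F t in at_top. mix_prob (window x L) t < a"
    using eventually_ge_at_top[of "real k + 1"]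
    by (elim eventually_mono) (use mix_prob_le_peak le_less_trans in blast)
qed

end

theorem theorem3:
  fixes M :: "'w measure" and T :: "int \<Rightarrow> 'w \<Rightarrow> real set" and n :: nat
    and \<eta>\<^sub>0 :: config and \<eta> :: "real \<Rightarrow> 'w \<Rightarrow> config"
  assumes "n > 1" and "odd n"
    and "majority_rule_model M T n \<eta>\<^sub>0 \<eta>"
  shows "clusters M \<eta>"
proof -
  interpret majority_rule_model M T n \<eta>\<^sub>0 \<eta> by fact
  show ?thesis
    unfolding clusters_def
  proof (intro allI)
    fix x y :: int
    define V where "V = window (min x y) (nat \<bar>y - x\<bar>)"
    have V: "x \<in> V" "y \<in> V" "finite V" by (auto simp: V_def window_def)
    have "((\<lambda>t. mix_prob V t) \<longlongrightarrow> 0) at_top"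
      unfolding V_def using assms by (intro mix_prob_tendsto_0)
    then show "((\<lambda>t. prob {\<omega> \<in> space M. (x \<in> \<eta> t \<omega>) \<noteq> (y \<in> \<eta> t \<omega>)}) \<longlongrightarrow> 0) at_top"
    proof (rule tendsto_sandwich[OF _ _ tendsto_const, rotated 2])
      show "\<forall>\<^sub>F t in at_top. prob {\<omega> \<in> space M. (x \<in> \<eta> t \<omega>) \<noteq> (y \<in> \<eta> t \<omega>)} \<le> mix_prob V t"
        using eventually_ge_at_top[of 0]
      proof eventually_elim
        case (elim t)
        then show ?case
          unfolding mix_prob_def using V
          by (intro finite_measure_mono events_mixed) (auto simp: mixed_def)
      qed
    qed simp
  qed
qed

end
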